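(* Let $(p_{ij} \colon X_j \to X_i)_{i \sqsubseteq j \in I}$ be a projective system of topological spaces, with canonical projective limit $X, (p_i)_{i \in I}$. Let $T$ be one of the functors $\mathbf V$, $\mathbf V_b$, $\mathbf V_1$, or $\mathbf V_{\leq 1}$. If: 1. the projective system is an ep-system, 2. or $I$ has a countable cofinal subset and each $X_i$ is locally compact sober, 3. or $I$ has a countable cofinal subset, $T$ is $\mathbf V_b$, $\mathbf V_1$ or $\mathbf V_{\leq 1}$, and each $X_i$ is LCS-complete, 4. or every $X_i$ is consonant sober and every $p_{ij}$ is a proper map, then $(T p_{ij} \colon T X_j \to T X_i)_{i \sqsubseteq j \in I}$ is a projective system of topological spaces, and $T X, (T p_i)_{i \in I}$ is its projective limit, up to homeomorphism.
   Context: **Topology.** $\mathcal O X$ is the lattice of open subsets of a space $X$. The specialization preordering is: $x \leq y$ iff every open neighborhood of $x$ contains $y$; $\uparrow A$, $\downarrow A$ denote upward and downward closures for $\leq$. A subset is saturated iff it is upwards-closed (equivalently, the intersection of its open neighborhoods). Compactness is the open cover property, with no separation axiom. $X$ is locally compact iff every point has a base of compact neighborhoods. $X$ is sober iff it is $T_0$ and every irreducible closed subset is the closure of a point. $X$ is LCS-complete iff it is homeomorphic to a $G_\delta$ subspace (countable intersection of open sets) of a locally compact sober space. $X$ is consonant iff for every Scott-open subset $\mathcal U$ of $\mathcal O X$ (ordered by inclusion) and every $U \in \mathcal U$, there is a compact saturated $Q \subseteq U$ all of whose open neighborhoods belong to $\mathcal U$. A continuous map $f \colon X \to Y$ is proper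 iff $\downarrow f[F]$ is closed for every closed $F \subseteq X$ and $f^{-1}(Q)$ is compact saturated for every compact saturated $Q \subseteq Y$. **Projective systems.** A projective system $(p_{ij} \colon X_j \to X_i)_{i \sqsubseteq j \in I}$ consists of a directed preordered set $(I,\sqsubseteq)$, spaces $X_i$, and continuous maps $p_{ij}$ ($i \sqsubseteq j$) with $p_{ii} = \mathrm{id}$ and $p_{ij} \circ p_{jk} = p_{ik}$ for $i \sqsubseteq j \sqsubseteq k$. Its canonical projective limit is $X = \{\vec x \in \prod_{i} X_i \mid p_{ij}(x_j) = x_i \text{ for all } i \sqsubseteq j\}$ with the subspace topology of the product, $p_i$ being projection onto coordinate $i$. Saying that $Y, (q_i)_{i\in I}$ is the projective limit up to homeomorphism of a projective system with canonical limit $Z$ means that the map $y \mapsto (q_i(y))_{i \in I}$ is a (well-defined) homeomorphism from $Y$ onto $Z$. The projective system is an ep-system iff there are continuous maps $e_{ij} \colon X_i \to X_j$ ($i \sqsubseteq j$) with $p_{ij} \circ e_{ij} = \mathrm{id}_{X_i}$, $e_{ij} \circ p_{ij} \leq \mathrm{id}_{X_j}$ (pointwise, in the specialization preordering of $X_j$), $e_{ii} = \mathrm{id}$, and $e_{jk} \circ e_{ij} = e_{ik}$. **Valuations.** $\overline{\mathbb R}_+ = \mathbb R_+ \cup \{\infty\}$. A continuous valuation on $X$ is a map $\nu \colon \mathcal O X \to \overline{\mathbb R}_+$ with $\nu(\emptyset)=0$, $\nu(U)+\nu(V)=\nu(U\cup V)+\nu(U\cap V)$, and which is Scott-continuous (monotonic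 and preserving directed suprema). $\mathbf V X$ is the space of all continuous valuations on $X$ with the weak topology, generated by the subbasic open sets $[U>r]=\{\nu \mid \nu(U)>r\}$, $U \in \mathcal O X$, $r \in \mathbb R_+$. $\mathbf V_b X$, $\mathbf V_1 X$, $\mathbf V_{\leq 1} X$ are the subspaces of those $\nu$ with $\nu(X)<\infty$, $\nu(X)=1$, $\nu(X)\leq 1$, respectively. Each is an endofunctor on the category of topological spaces; a continuous map $f\colon X\to Y$ acts by $\nu \mapsto f[\nu]$, where $f[\nu](V)=\nu(f^{-1}(V))$. *)

theory Defs
  imports "HOL-Analysis.Analysis"
begin

section \<open>Non-Hausdorff topology\<close>

definition spec_le :: "'a topology \<Rightarrow> 'a \<Rightarrow> 'a \<Rightarrow> bool" where
  "spec_le X x y \<longleftrightarrow> x \<in> topspace X \<and> y \<in> topspace X \<and> (\<forall>U. openin X U \<and> x \<in> U \<longrightarrow> y \<in> U)"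

definition down_closure :: "'a topology \<Rightarrow> 'a set \<Rightarrow> 'a set" where
  "down_closure X A = {x. \<exists>a\<in>A. spec_le X x a}"

definition saturated_in :: "'a topology \<Rightarrow> 'a set \<Rightarrow> bool" where
  "saturated_in X A \<longleftrightarrow> A \<subseteq> topspace X \<and> (\<forall>x y. x \<in> A \<and> spec_le X x y \<longrightarrow> y \<in> A)"

definition irreducible_closedin :: "'a topology \<Rightarrow> 'a set \<Rightarrow> bool" where
  "irreducible_closedin X C \<longleftrightarrow> closedin X C \<and> C \<noteq> {} \<and>
     (\<forall>A B. closedin X A \<and> closedin X B \<and> C \<subseteq> A \<union> B \<longrightarrow> C \<subseteq> A \<or> C \<subseteq> B)"

definition sober_space :: "'a topology \<Rightarrow> bool" where
  "sober_space X \<longleftrightarrow> t0_space X \<and>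
     (\<forall>C. irreducible_closedin X C \<longrightarrow> (\<exists>x\<in>topspace X. C = X closure_of {x}))"

text \<open>
  The library's \<open>locally_compact_space\<close> only asks for one compact neighbourhood of each point,
  which is weaker in the absence of separation axioms: here, each point must have a base of
  compact neighbourhoods.
\<close>

definition loc_compact_space :: "'a topology \<Rightarrow> bool" where
  "loc_compact_space X \<longleftrightarrow> neighbourhood_base_of (compactin X) X"

text \<open>
  HOL cannot quantify existentially over the carrier type of the ambient locally compact sober
  space, hence the type argument.  A theorem assuming \<open>lcs_complete TYPE('c) X\<close> for a type
  variable \<open>'c\<close> applies whatever the carrier type of that space.
\<close>

definition lcs_complete :: "'c itself \<Rightarrow> 'a topology \<Rightarrow> bool" where
  "lcs_complete _ X \<longleftrightarrow>
     (\<exists>(Y :: 'c topology) S. loc_compact_space Y \<and> sober_space Y \<and> gdelta_in Y S \<and>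
        X homeomorphic_space (subtopology Y S))"

definition directed_opens :: "'a topology \<Rightarrow> 'a set set \<Rightarrow> bool" where
  "directed_opens X D \<longleftrightarrow> D \<noteq> {} \<and> (\<forall>U\<in>D. openin X U) \<and>
     (\<forall>U\<in>D. \<forall>V\<in>D. \<exists>W\<in>D. U \<subseteq> W \<and> V \<subseteq> W)"

definition scott_open_family :: "'a topology \<Rightarrow> 'a set set \<Rightarrow> bool" where
  "scott_open_family X \<U> \<longleftrightarrow> (\<forall>U\<in>\<U>. openin X U) \<and>
     (\<forall>U V. U \<in> \<U> \<and> openin X V \<and> U \<subseteq> V \<longrightarrow> V \<in> \<U>) \<and>
     (\<forall>D. directed_opens X D \<and> \<Union>D \<in> \<U> \<longrightarrow> (\<exists>U\<in>D. U \<in> \<U>))"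

definition consonant_space :: "'a topology \<Rightarrow> bool" where
  "consonant_space X \<longleftrightarrow>
     (\<forall>\<U> U. scott_open_family X \<U> \<and> U \<in> \<U> \<longrightarrow>
        (\<exists>Q. compactin X Q \<and> saturated_in X Q \<and> Q \<subseteq> U \<and>
             (\<forall>V. openin X V \<and> Q \<subseteq> V \<longrightarrow> V \<in> \<U>)))"

text \<open>
  This is a different notion from the library's \<open>proper_map\<close> (closed map with compact fibres).
\<close>

definition order_proper_map :: "'a topology \<Rightarrow> 'b topology \<Rightarrow> ('a \<Rightarrow> 'b) \<Rightarrow> bool" where
  "order_proper_map X Y f \<longleftrightarrow> continuous_map X Y f \<and>
     (\<forall>F. closedin X F \<longrightarrow> closedin Y (down_closure Y (f ` F))) \<and>
     (\<forall>Q. compactin Y Q \<and> saturated_in Y Q \<longrightarrow>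
        compactin X {x \<in> topspace X. f x \<in> Q} \<and> saturated_in X {x \<in> topspace X. f x \<in> Q})"

section \<open>Projective systems\<close>

text \<open>
  \<open>(i, j) \<in> r\<close> stands for \<open>i \<sqsubseteq> j\<close>, and \<open>p i j\<close> maps \<open>X j\<close> to \<open>X i\<close>.  Directed sets are nonempty.
\<close>

definition directed_preorder_on :: "'i set \<Rightarrow> 'i rel \<Rightarrow> bool" where
  "directed_preorder_on I r \<longleftrightarrow> preorder_on I r \<and> I \<noteq> {} \<and>
     (\<forall>i\<in>I. \<forall>j\<in>I. \<exists>k\<in>I. (i, k) \<in> r \<and> (j, k) \<in> r)"

definition countably_cofinal :: "'i set \<Rightarrow> 'i rel \<Rightarrow> bool" where
  "countably_cofinal I r \<longleftrightarrow> (\<exists>J\<subseteq>I. countable J \<and> (\<forall>i\<in>I. \<exists>j\<in>J. (i, j) \<in> r))"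

definition projective_system ::
  "'i set \<Rightarrow> 'i rel \<Rightarrow> ('i \<Rightarrow> 'a topology) \<Rightarrow> ('i \<Rightarrow> 'i \<Rightarrow> 'a \<Rightarrow> 'a) \<Rightarrow> bool" where
  "projective_system I r X p \<longleftrightarrow> directed_preorder_on I r \<and>
     (\<forall>i j. (i, j) \<in> r \<longrightarrow> continuous_map (X j) (X i) (p i j)) \<and>
     (\<forall>i\<in>I. \<forall>x\<in>topspace (X i). p i i x = x) \<and>
     (\<forall>i j k. (i, j) \<in> r \<and> (j, k) \<in> r \<longrightarrow>
        (\<forall>x\<in>topspace (X k). p i j (p j k x) = p i k x))"

definition ep_system ::
  "'i set \<Rightarrow> 'i rel \<Rightarrow> ('i \<Rightarrow> 'a topology) \<Rightarrow> ('i \<Rightarrow> 'i \<Rightarrow> 'a \<Rightarrow> 'a) \<Rightarrow> bool" where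
  "ep_system I r X p \<longleftrightarrow> projective_system I r X p \<and>
     (\<exists>e :: 'i \<Rightarrow> 'i \<Rightarrow> 'a \<Rightarrow> 'a.
        (\<forall>i j. (i, j) \<in> r \<longrightarrow> continuous_map (X i) (X j) (e i j) \<and>
           (\<forall>x\<in>topspace (X i). p i j (e i j x) = x) \<and>
           (\<forall>y\<in>topspace (X j). spec_le (X j) (e i j (p i j y)) y)) \<and>
        (\<forall>i\<in>I. \<forall>x\<in>topspace (X i). e i i x = x) \<and>
        (\<forall>i j k. (i, j) \<in> r \<and> (j, k) \<in> r \<longrightarrow>
           (\<forall>x\<in>topspace (X i). e j k (e i j x) = e i k x)))"

definition proj_lim ::
  "'i set \<Rightarrow> 'i rel \<Rightarrow> ('i \<Rightarrow> 'a topology) \<Rightarrow> ('i \<Rightarrow> 'i \<Rightarrow> 'a \<Rightarrow> 'a) \<Rightarrow> ('i \<Rightarrow> 'a) topology" where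
  "proj_lim I r X p =
     subtopology (product_topology X I)
       {x \<in> (\<Pi>\<^sub>E i\<in>I. topspace (X i)). \<forall>i j. (i, j) \<in> r \<longrightarrow> p i j (x j) = x i}"

definition is_proj_lim ::
  "'i set \<Rightarrow> 'i rel \<Rightarrow> ('i \<Rightarrow> 'a topology) \<Rightarrow> ('i \<Rightarrow> 'i \<Rightarrow> 'a \<Rightarrow> 'a) \<Rightarrow>
   'b topology \<Rightarrow> ('i \<Rightarrow> 'b \<Rightarrow> 'a) \<Rightarrow> bool" where
  "is_proj_lim I r X p Y q \<longleftrightarrow> homeomorphic_map Y (proj_lim I r X p) (\<lambda>y. \<lambda>i\<in>I. q i y)"

section \<open>Continuous valuations\<close>

text \<open>
  A map on the open sets of \<open>X\<close> is represented by a function on all sets that is \<open>undefined\<close>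
  outside the open sets, so that equality of valuations is equality on open sets.
\<close>

definition continuous_valuation :: "'a topology \<Rightarrow> ('a set \<Rightarrow> ennreal) \<Rightarrow> bool" where
  "continuous_valuation X \<nu> \<longleftrightarrow> \<nu> \<in> extensional {U. openin X U} \<and>
     \<nu> {} = 0 \<and>
     (\<forall>U V. openin X U \<and> openin X V \<longrightarrow> \<nu> U + \<nu> V = \<nu> (U \<union> V) + \<nu> (U \<inter> V)) \<and>
     (\<forall>U V. openin X U \<and> openin X V \<and> U \<subseteq> V \<longrightarrow> \<nu> U \<le> \<nu> V) \<and>
     (\<forall>D. directed_opens X D \<longrightarrow> \<nu> (\<Union>D) = (SUP U\<in>D. \<nu> U))"

text \<open>
  The whole set of valuations is added to the subbase because the sets \<open>[U > r]\<close> do not cover it: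
  none of them contains the zero valuation.
\<close>

definition weak_topology :: "'a topology \<Rightarrow> ('a set \<Rightarrow> ennreal) topology" where
  "weak_topology X =
     topology_generated_by
       (insert {\<nu>. continuous_valuation X \<nu>}
          {{\<nu>. continuous_valuation X \<nu> \<and> \<nu> U > ennreal r} | U r. openin X U \<and> (r::real) \<ge> 0})"

datatype valuation_functor = Val | Val_b | Val_1 | Val_le1

fun val_space :: "valuation_functor \<Rightarrow> 'a topology \<Rightarrow> ('a set \<Rightarrow> ennreal) topology" where
  "val_space Val X = weak_topology X"
| "val_space Val_b X = subtopology (weak_topology X) {\<nu>. \<nu> (topspace X) < \<infinity>}"
| "val_space Val_1 X = subtopology (weak_topology X) {\<nu>. \<nu> (topspace X) = 1}"
| "val_space Val_le1 X = subtopology (weak_topology X) {\<nu>. \<nu> (topspace X) \<le> 1}"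

definition val_map ::
  "'a topology \<Rightarrow> 'b topology \<Rightarrow> ('a \<Rightarrow> 'b) \<Rightarrow> ('a set \<Rightarrow> ennreal) \<Rightarrow> ('b set \<Rightarrow> ennreal)" where
  "val_map X Y f \<nu> = restrict (\<lambda>V. \<nu> {x \<in> topspace X. f x \<in> V}) {V. openin Y V}"

end

theory Submission
  imports Defs
begin

text \<open>
  Every open set \<open>U\<close> of the limit \<open>X\<close> is the directed union of the preimages of the open sets
  \<open>core U i\<close>, where \<open>core U i\<close> is the largest open set of \<open>X\<^sub>i\<close> whose preimage lies in \<open>U\<close>.  A
  continuous valuation on \<open>X\<close> is therefore determined by its images, and a compatible family of
  valuations \<open>\<nu>\<^sub>i\<close> can only come from \<open>U \<mapsto> sup\<^sub>i \<nu>\<^sub>i (core U i)\<close> (\<open>glue\<close>).  This formula also makes the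
  correspondence a homeomorphism as soon as it is a bijection, and the total mass is preserved, so
  the four functors behave in the same way.

  What remains is to show that the formula defines a continuous valuation with images \<open>\<nu>\<^sub>i\<close>.  The
  cores of a union can be larger than the unions of the cores, so the supremum has to be computable from
  any increasing family of open sets that presents \<open>U\<close>.  This amounts to one covering
  condition (\<open>tight\<close>): if the preimages of a compatible family of open sets \<open>W\<^sub>j\<close> cover the preimage
  of an open set \<open>V\<close> of \<open>X\<^sub>i\<close>, then \<open>\<nu>\<^sub>i V \<le> sup\<^sub>j \<nu>\<^sub>j W\<^sub>j\<close>.  Lemma \<open>projective_limit_val_space\<close> deduces
  the conclusion from this condition alone; the hypotheses on the system serve to establish it.

  In an ep-system (\<open>tight_ep_system\<close>) each \<open>X\<^sub>i\<close> embeds into the limit, and pulling the cover back along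
  the embedding turns the condition into the Scott-continuity of \<open>\<nu>\<^sub>i\<close>.  In the other cases, if
  \<open>\<nu>\<^sub>i V > c\<close> while every \<open>\<nu>\<^sub>j W\<^sub>j\<close> is at most \<open>c\<close>, one constructs a point of the limit that lies over \<open>V\<close>
  and in no \<open>W\<^sub>j\<close>.  Points come from Scott-open filters of open sets, compatible with the bonding
  maps, to which the \<open>W\<^sub>j\<close> do not belong (\<open>limit_point_of_scott_filters\<close>, a common extension of
  Steenrod's theorem on limits of compact sober spaces and of the Hofmann-Mislove theorem).  For
  consonant spaces and proper maps (\<open>tight_consonant\<close>) they are the neighbourhood filters of the
  preimages of one compact saturated set.  For LCS-complete spaces, which include the
  locally compact sober ones, and a cofinal sequence of indices, they come from an infinite
  construction that shrinks open sets at all the levels in turn, keeping the mass above \<open>c\<close>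
  (\<open>tight_gdelta_sequence\<close>).
\<close>

section \<open>Continuous valuations and their images\<close>

lemma continuous_valuation_empty: "continuous_valuation X \<nu> \<Longrightarrow> \<nu> {} = 0"
  by (simp add: continuous_valuation_def)

lemma continuous_valuation_mono:
  "continuous_valuation X \<nu> \<Longrightarrow> openin X U \<Longrightarrow> openin X V \<Longrightarrow> U \<subseteq> V \<Longrightarrow> \<nu> U \<le> \<nu> V"
  by (simp add: continuous_valuation_def)

lemma continuous_valuation_modular:
  "continuous_valuation X \<nu> \<Longrightarrow> openin X U \<Longrightarrow> openin X V
    \<Longrightarrow> \<nu> U + \<nu> V = \<nu> (U \<union> V) + \<nu> (U \<inter> V)"
  by (simp add: continuous_valuation_def)

lemma continuous_valuation_Union:
  "continuous_valuation X \<nu> \<Longrightarrow> directed_opens X D \<Longrightarrow> \<nu> (\<Union>D) = (SUP U\<in>D. \<nu> U)"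
  by (simp add: continuous_valuation_def)

lemma continuous_valuation_UN:
  assumes "continuous_valuation X \<nu>" "J \<noteq> {}" "\<And>j. j \<in> J \<Longrightarrow> openin X (A j)"
    "\<And>j k. j \<in> J \<Longrightarrow> k \<in> J \<Longrightarrow> \<exists>l\<in>J. A j \<subseteq> A l \<and> A k \<subseteq> A l"
  shows "\<nu> (\<Union>j\<in>J. A j) = (SUP j\<in>J. \<nu> (A j))"
proof -
  have "directed_opens X (A ` J)"
    unfolding directed_opens_def
  proof (intro conjI ballI)
    show "A ` J \<noteq> {}" using assms(2) by simp
    show "openin X U" if "U \<in> A ` J" for U using that assms(3) by auto
    fix U V assume "U \<in> A ` J" "V \<in> A ` J"
    then obtain j k where jk: "j \<in> J" "k \<in> J" "U = A j" "V = A k" by auto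
    then obtain l where "l \<in> J" "A j \<subseteq> A l" "A k \<subseteq> A l" using assms(4) by meson
    then show "\<exists>W\<in>A ` J. U \<subseteq> W \<and> V \<subseteq> W" using jk by (intro bexI[of _ "A l"]) auto
  qed
  then show ?thesis
    using continuous_valuation_Union[OF assms(1), of "A ` J"] by (simp add: image_image)
qed

lemma directed_opens_upper_bound:
  "directed_opens X D \<Longrightarrow> U \<in> D \<Longrightarrow> V \<in> D \<Longrightarrow> \<exists>W\<in>D. U \<subseteq> W \<and> V \<subseteq> W"
  unfolding directed_opens_def by (elim conjE) (drule (1) bspec, drule (1) bspec)

lemma directed_opens_preimage:
  assumes f: "continuous_map X Y f" and D: "directed_opens Y D"
  shows "directed_opens X ((\<lambda>V. {x \<in> topspace X. f x \<in> V}) ` D)"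
proof -
  have "\<exists>W\<in>D. {x \<in> topspace X. f x \<in> U} \<subseteq> {x \<in> topspace X. f x \<in> W} \<and>
      {x \<in> topspace X. f x \<in> V} \<subseteq> {x \<in> topspace X. f x \<in> W}" if "U \<in> D" "V \<in> D" for U V
  proof -
    obtain W where "W \<in> D" "U \<subseteq> W" "V \<subseteq> W"
      using directed_opens_upper_bound[OF D \<open>U \<in> D\<close> \<open>V \<in> D\<close>] by blast
    then show ?thesis by (intro bexI[of _ W]) auto
  qed
  then show ?thesis
    using D openin_continuous_map_preimage[OF f] unfolding directed_opens_def by auto
qed

lemma scott_open_family_above_mass:
  assumes "continuous_valuation X \<nu>"
  shows "scott_open_family X {U. openin X U \<and> c < \<nu> U}"
  unfolding scott_open_family_def
proof (intro conjI allI impI ballI)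
  fix D assume D: "directed_opens X D \<and> \<Union>D \<in> {U. openin X U \<and> c < \<nu> U}"
  then have "c < (SUP U\<in>D. \<nu> U)"
    using continuous_valuation_Union[OF assms, of D] by simp
  then obtain U where "U \<in> D" "c < \<nu> U" unfolding less_SUP_iff by blast
  then show "\<exists>U\<in>D. U \<in> {U. openin X U \<and> c < \<nu> U}"
    using D by (intro bexI[of _ U]) (simp_all add: directed_opens_def)
next
  fix U V assume "U \<in> {U. openin X U \<and> c < \<nu> U} \<and> openin X V \<and> U \<subseteq> V"
  then show "V \<in> {U. openin X U \<and> c < \<nu> U}"
    using continuous_valuation_mono[OF assms, of U V] by (auto intro: less_le_trans)
qed auto

lemma val_map_apply [simp]:
  "openin Y V \<Longrightarrow> val_map X Y f \<nu> V = \<nu> {x \<in> topspace X. f x \<in> V}"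
  by (simp add: val_map_def)

lemma continuous_valuation_val_map:
  assumes f: "continuous_map X Y f" and \<nu>: "continuous_valuation X \<nu>"
  shows "continuous_valuation Y (val_map X Y f \<nu>)"
proof -
  let ?pre = "\<lambda>V. {x \<in> topspace X. f x \<in> V}"
  have op: "openin X (?pre V)" if "openin Y V" for V
    using that openin_continuous_map_preimage[OF f] by blast
  have pre_Un: "?pre (U \<union> V) = ?pre U \<union> ?pre V" "?pre (U \<inter> V) = ?pre U \<inter> ?pre V" for U V
    by auto
  have Union: "\<nu> (?pre (\<Union>D)) = (SUP U\<in>D. \<nu> (?pre U))" if "directed_opens Y D" for D
  proof -
    have "?pre (\<Union>D) = \<Union>(?pre ` D)" by auto
    then show ?thesis
      using continuous_valuation_Union[OF \<nu> directed_opens_preimage[OF f that]]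
      by (simp add: image_image)
  qed
  have modular: "\<nu> (?pre U) + \<nu> (?pre V) = \<nu> (?pre (U \<union> V)) + \<nu> (?pre (U \<inter> V))"
    if "openin Y U" "openin Y V" for U V
    unfolding pre_Un using continuous_valuation_modular[OF \<nu> op op] that by blast
  have mono: "\<nu> (?pre U) \<le> \<nu> (?pre V)" if "openin Y U" "openin Y V" "U \<subseteq> V" for U V
    using that by (intro continuous_valuation_mono[OF \<nu> op op]) auto
  show ?thesis
    unfolding continuous_valuation_def
  proof (intro conjI allI impI)
    show "val_map X Y f \<nu> \<in> extensional {U. openin Y U}"
      by (simp add: val_map_def)
    show "val_map X Y f \<nu> {} = 0"
      using continuous_valuation_empty[OF \<nu>] by simp
    show "val_map X Y f \<nu> U + val_map X Y f \<nu> V =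
        val_map X Y f \<nu> (U \<union> V) + val_map X Y f \<nu> (U \<inter> V)"
      if "openin Y U \<and> openin Y V" for U V
      using that modular[of U V] by (simp only: val_map_apply openin_Un openin_Int)
    show "val_map X Y f \<nu> U \<le> val_map X Y f \<nu> V"
      if "openin Y U \<and> openin Y V \<and> U \<subseteq> V" for U V
      using that mono[of U V] by simp
    show "val_map X Y f \<nu> (\<Union>D) = (SUP U\<in>D. val_map X Y f \<nu> U)" if "directed_opens Y D" for D
    proof -
      have D: "\<And>U. U \<in> D \<Longrightarrow> openin Y U" using that by (simp add: directed_opens_def)
      then have "val_map X Y f \<nu> (\<Union>D) = \<nu> (?pre (\<Union>D))"
        by (intro val_map_apply openin_Union)
      also have "\<dots> = (SUP U\<in>D. val_map X Y f \<nu> U)"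
        unfolding Union[OF that] using D by (intro SUP_cong) simp_all
      finally show ?thesis .
    qed
  qed
qed

lemma continuous_valuation_eqI:
  assumes "continuous_valuation X \<mu>" "continuous_valuation X \<nu>" "\<And>U. openin X U \<Longrightarrow> \<mu> U = \<nu> U"
  shows "\<mu> = \<nu>"
  using assms unfolding continuous_valuation_def by (auto intro!: extensionalityI)

lemma val_map_id:
  assumes "continuous_valuation X \<nu>" "\<And>x. x \<in> topspace X \<Longrightarrow> f x = x"
  shows "val_map X X f \<nu> = \<nu>"
proof (rule extensionalityI)
  fix U assume "U \<in> {U. openin X U}"
  moreover from this have "{x \<in> topspace X. f x \<in> U} = U"
    using assms(2) openin_subset by fastforce
  ultimately show "val_map X X f \<nu> U = \<nu> U" by simp
qed (use assms in \<open>auto simp: val_map_def continuous_valuation_def\<close>)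

lemma val_map_compose:
  assumes f: "continuous_map X Y f" and g: "continuous_map Y Z g"
    and h: "\<And>x. x \<in> topspace X \<Longrightarrow> g (f x) = h x"
  shows "val_map Y Z g (val_map X Y f \<nu>) = val_map X Z h \<nu>"
proof
  fix V
  have "{x \<in> topspace X. f x \<in> {y \<in> topspace Y. g y \<in> V}} = {x \<in> topspace X. h x \<in> V}"
    using h continuous_map_image_subset_topspace[OF f] by auto
  then show "val_map Y Z g (val_map X Y f \<nu>) V = val_map X Z h \<nu> V"
    using openin_continuous_map_preimage[OF g] by (auto simp: val_map_def)
qed

section \<open>The spaces of valuations\<close>

text \<open>The four functors are treated uniformly: they differ by a condition on the total mass, and
  the total mass is invariant under images.\<close>

fun mass_condition :: "valuation_functor \<Rightarrow> ennreal \<Rightarrow> bool" where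
  "mass_condition Val m \<longleftrightarrow> True"
| "mass_condition Val_b m \<longleftrightarrow> m < \<infinity>"
| "mass_condition Val_1 m \<longleftrightarrow> m = 1"
| "mass_condition Val_le1 m \<longleftrightarrow> m \<le> 1"

lemma val_space_eq_subtopology:
  "val_space T X = subtopology (weak_topology X) {\<nu>. mass_condition T (\<nu> (topspace X))}"
  by (cases T) simp_all

lemma topspace_weak_topology: "topspace (weak_topology X) = {\<nu>. continuous_valuation X \<nu>}"
  by (auto simp: weak_topology_def)

lemma topspace_val_space:
  "topspace (val_space T X) =
    {\<nu>. continuous_valuation X \<nu> \<and> mass_condition T (\<nu> (topspace X))}"
  by (auto simp: val_space_eq_subtopology topspace_weak_topology)

lemma openin_val_space_greater:
  assumes "openin X U" "0 \<le> c"
  shows "openin (val_space T X) {\<nu> \<in> topspace (val_space T X). ennreal c < \<nu> U}"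
proof -
  have "openin (weak_topology X) {\<nu>. continuous_valuation X \<nu> \<and> ennreal c < \<nu> U}"
    unfolding weak_topology_def using assms
    by (intro topology_generated_by_Basis) auto
  moreover have "{\<nu> \<in> topspace (val_space T X). ennreal c < \<nu> U} =
      {\<nu>. continuous_valuation X \<nu> \<and> ennreal c < \<nu> U} \<inter> {\<nu>. mass_condition T (\<nu> (topspace X))}"
    by (auto simp: topspace_val_space)
  ultimately show ?thesis
    by (auto simp: val_space_eq_subtopology openin_subtopology)
qed

lemma continuous_map_into_val_space:
  assumes "\<And>z. z \<in> topspace Z \<Longrightarrow> f z \<in> topspace (val_space T X)"
    and "\<And>U c. openin X U \<Longrightarrow> 0 \<le> c \<Longrightarrow> openin Z {z \<in> topspace Z. ennreal c < f z U}"
  shows "continuous_map Z (val_space T X) f"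
proof -
  have cv: "continuous_valuation X (f z)" if "z \<in> topspace Z" for z
    using assms(1)[OF that] by (simp add: topspace_val_space)
  have *: "{z. continuous_valuation X (f z)} \<inter> topspace Z = topspace Z"
    "{z. continuous_valuation X (f z) \<and> ennreal c < f z U} \<inter> topspace Z =
      {z \<in> topspace Z. ennreal c < f z U}" for U c
    using cv by auto
  have "continuous_map Z (weak_topology X) f"
    unfolding weak_topology_def continuous_on_generated_topo_iff
    using cv assms(2) by (auto simp: *)
  then show ?thesis
    using assms(1)
    by (auto simp: val_space_eq_subtopology continuous_map_in_subtopology)
qed

lemma val_map_in_val_space:
  assumes f: "continuous_map X Y f" and \<nu>: "\<nu> \<in> topspace (val_space T X)"
  shows "val_map X Y f \<nu> \<in> topspace (val_space T Y)"
proof -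
  have "{x \<in> topspace X. f x \<in> topspace Y} = topspace X"
    using continuous_map_image_subset_topspace[OF f] by auto
  then show ?thesis
    using \<nu> continuous_valuation_val_map[OF f] by (simp add: topspace_val_space)
qed

lemma continuous_map_val_map:
  assumes f: "continuous_map X Y f"
  shows "continuous_map (val_space T X) (val_space T Y) (val_map X Y f)"
proof (rule continuous_map_into_val_space)
  show "openin (val_space T X) {\<nu> \<in> topspace (val_space T X). ennreal c < val_map X Y f \<nu> U}"
    if "openin Y U" "0 \<le> c" for U c
    using openin_val_space_greater[OF openin_continuous_map_preimage[OF f]] that by simp
qed (rule val_map_in_val_space[OF f])

section \<open>Projective limits and compatible families of open sets\<close>

locale projective_sys =
  fixes I :: "'i set" and r :: "'i rel" and X :: "'i \<Rightarrow> 'a topology" and p :: "'i \<Rightarrow> 'i \<Rightarrow> 'a \<Rightarrow> 'a"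
  assumes sys: "projective_system I r X p"
begin

abbreviation L :: "('i \<Rightarrow> 'a) topology" where "L \<equiv> proj_lim I r X p"

abbreviation pre :: "'i \<Rightarrow> 'i \<Rightarrow> 'a set \<Rightarrow> 'a set" where
  "pre i j V \<equiv> {x \<in> topspace (X j). p i j x \<in> V}"

abbreviation lpre :: "'i \<Rightarrow> 'a set \<Rightarrow> ('i \<Rightarrow> 'a) set" where
  "lpre i V \<equiv> {x \<in> topspace L. x i \<in> V}"

lemma directed_index: "directed_preorder_on I r"
  using sys by (simp add: projective_system_def)

lemma preorder_index: "preorder_on I r"
  using directed_index by (simp add: directed_preorder_on_def)

lemma index_nonempty: "I \<noteq> {}"
  using directed_index by (simp add: directed_preorder_on_def)

lemma index_mem: "(i, j) \<in> r \<Longrightarrow> i \<in> I" "(i, j) \<in> r \<Longrightarrow> j \<in> I"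
  using preorder_index by (auto simp: preorder_on_def)

lemma index_refl: "i \<in> I \<Longrightarrow> (i, i) \<in> r"
  using preorder_index by (simp add: preorder_on_def refl_on_def)

lemma index_trans: "(i, j) \<in> r \<Longrightarrow> (j, k) \<in> r \<Longrightarrow> (i, k) \<in> r"
  using preorder_index unfolding preorder_on_def by (meson transD)

lemma index_upper_bound:
  assumes "i \<in> I" "j \<in> I"
  obtains k where "(i, k) \<in> r" "(j, k) \<in> r" "k \<in> I"
proof -
  have "\<forall>i\<in>I. \<forall>j\<in>I. \<exists>k\<in>I. (i, k) \<in> r \<and> (j, k) \<in> r"
    using directed_index unfolding directed_preorder_on_def by (elim conjE)
  then show ?thesis using assms that by meson
qed

lemma index_finite_upper_bound:
  assumes "finite J" "J \<subseteq> I"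
  shows "\<exists>k\<in>I. \<forall>j\<in>J. (j, k) \<in> r"
  using assms
proof (induction J)
  case empty
  then show ?case using index_nonempty by auto
next
  case (insert i J)
  then obtain k where k: "k \<in> I" "\<forall>j\<in>J. (j, k) \<in> r" by auto
  obtain l where "(i, l) \<in> r" "(k, l) \<in> r" "l \<in> I"
    using index_upper_bound[of i k] insert.prems k(1) by blast
  then show ?case using k index_trans by (intro bexI[of _ l]) auto
qed

lemma bond_continuous: "(i, j) \<in> r \<Longrightarrow> continuous_map (X j) (X i) (p i j)"
  and bond_id: "i \<in> I \<Longrightarrow> x \<in> topspace (X i) \<Longrightarrow> p i i x = x"
  and bond_compose: "(i, j) \<in> r \<Longrightarrow> (j, k) \<in> r \<Longrightarrow> x \<in> topspace (X k) \<Longrightarrow> p i j (p j k x) = p i k x"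
  using sys unfolding projective_system_def by (simp_all del: split_paired_All)

lemma bond_mem: "(i, j) \<in> r \<Longrightarrow> x \<in> topspace (X j) \<Longrightarrow> p i j x \<in> topspace (X i)"
  using continuous_map_image_subset_topspace[OF bond_continuous] by blast

lemma openin_pre: "(i, j) \<in> r \<Longrightarrow> openin (X i) V \<Longrightarrow> openin (X j) (pre i j V)"
  using openin_continuous_map_preimage[OF bond_continuous] .

lemma pre_self: "i \<in> I \<Longrightarrow> V \<subseteq> topspace (X i) \<Longrightarrow> pre i i V = V"
  using bond_id by fastforce

lemma pre_pre:
  assumes "(i, j) \<in> r" "(j, k) \<in> r"
  shows "pre j k (pre i j V) = pre i k V"
  using bond_compose[OF assms] bond_mem[OF assms(2)] by auto

lemma topspace_limit:
  "topspace L = {x \<in> (\<Pi>\<^sub>E i\<in>I. topspace (X i)). \<forall>i j. (i, j) \<in> r \<longrightarrow> p i j (x j) = x i}"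
  by (auto simp: proj_lim_def)

lemma limit_mem: "x \<in> topspace L \<Longrightarrow> i \<in> I \<Longrightarrow> x i \<in> topspace (X i)"
  and limit_bond: "x \<in> topspace L \<Longrightarrow> (i, j) \<in> r \<Longrightarrow> p i j (x j) = x i"
  unfolding topspace_limit by auto

lemma continuous_map_projection: "i \<in> I \<Longrightarrow> continuous_map L (X i) (\<lambda>x. x i)"
  unfolding proj_lim_def
  by (intro continuous_map_from_subtopology continuous_map_product_projection)

lemma openin_lpre: "i \<in> I \<Longrightarrow> openin (X i) V \<Longrightarrow> openin L (lpre i V)"
  using openin_continuous_map_preimage[OF continuous_map_projection] .

lemma lpre_pre: "(i, j) \<in> r \<Longrightarrow> lpre j (pre i j V) = lpre i V"
  using limit_mem limit_bond index_mem by auto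

text \<open>Directedness of the index set lets a single coordinate do the work of finitely many.\<close>

lemma open_limit_basis:
  assumes U: "openin L U" and x: "x \<in> U"
  obtains i V where "i \<in> I" "openin (X i) V" "x i \<in> V" "lpre i V \<subseteq> U"
proof -
  have xL: "x \<in> topspace L" using U x openin_subset by blast
  obtain U' where U': "openin (product_topology X I) U'" and
    U_eq: "U = U' \<inter> {x \<in> (\<Pi>\<^sub>E i\<in>I. topspace (X i)). \<forall>i j. (i, j) \<in> r \<longrightarrow> p i j (x j) = x i}"
    using U unfolding proj_lim_def openin_subtopology by blast
  then obtain B where B: "x \<in> (\<Pi>\<^sub>E i\<in>I. B i)" "\<And>i. openin (X i) (B i)"
      "finite {i. B i \<noteq> topspace (X i)}" "(\<Pi>\<^sub>E i\<in>I. B i) \<subseteq> U'"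
    using product_topology_open_contains_basis[OF U', of x] x by blast
  define J where "J = {i \<in> I. B i \<noteq> topspace (X i)}"
  have J: "finite J" "J \<subseteq> I" using B(3) by (auto simp: J_def)
  then obtain k where k: "k \<in> I" "\<forall>j\<in>J. (j, k) \<in> r" using index_finite_upper_bound by blast
  define V where "V = topspace (X k) \<inter> (\<Inter>j\<in>J. pre j k (B j))"
  have "openin (X k) V"
    using J k B(2) openin_pre unfolding V_def by (auto intro!: openin_Int_Inter)
  moreover have "x k \<in> V"
    using xL k J(2) B(1) limit_mem[OF xL] limit_bond[OF xL] by (auto simp: V_def)
  moreover have "lpre k V \<subseteq> U"
  proof
    fix y assume "y \<in> lpre k V"
    then have y: "y \<in> topspace L" "y k \<in> V" by auto
    have "y i \<in> B i" if "i \<in> I" for i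
    proof (cases "i \<in> J")
      case True
      then have "p i k (y k) \<in> B i" using y(2) by (auto simp: V_def)
      then show ?thesis using limit_bond[OF y(1)] True k by auto
    next
      case False
      then show ?thesis using that limit_mem[OF y(1)] by (auto simp: J_def)
    qed
    moreover have "y \<in> extensional I" using y(1) unfolding topspace_limit PiE_def by blast
    ultimately have "y \<in> (\<Pi>\<^sub>E i\<in>I. B i)" by (simp add: PiE_iff)
    then have "y \<in> U'" using B(4) by blast
    then show "y \<in> U" using y(1) by (auto simp: U_eq topspace_limit)
  qed
  ultimately show ?thesis using that k(1) by blast
qed

text \<open>A compatible family approximates, in an increasing way along the system, the open subset
  \<open>\<Union>i\<in>I. lpre i (W i)\<close> of the limit.  It is a formal counterpart of that open set which makes sense
  without the points of the limit; different families may present the same open set.\<close>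

definition compatible :: "('i \<Rightarrow> 'a set) \<Rightarrow> bool" where
  "compatible W \<longleftrightarrow> (\<forall>i\<in>I. openin (X i) (W i)) \<and> (\<forall>i j. (i, j) \<in> r \<longrightarrow> pre i j (W i) \<subseteq> W j)"

lemma compatible_openin: "compatible W \<Longrightarrow> i \<in> I \<Longrightarrow> openin (X i) (W i)"
  and compatible_pre: "compatible W \<Longrightarrow> (i, j) \<in> r \<Longrightarrow> pre i j (W i) \<subseteq> W j"
  by (auto simp: compatible_def)

lemma compatible_Un: "compatible V \<Longrightarrow> compatible W \<Longrightarrow> compatible (\<lambda>i. V i \<union> W i)"
  unfolding compatible_def by blast

lemma compatible_Int: "compatible V \<Longrightarrow> compatible W \<Longrightarrow> compatible (\<lambda>i. V i \<inter> W i)"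
  unfolding compatible_def by blast

lemma compatible_UN:
  assumes "\<And>c. c \<in> C \<Longrightarrow> compatible (W c)" shows "compatible (\<lambda>i. \<Union>c\<in>C. W c i)"
  using assms unfolding compatible_def by blast

text \<open>The least compatible family containing \<open>V\<close> at index \<open>i\<close>.\<close>

definition generated :: "'i \<Rightarrow> 'a set \<Rightarrow> 'i \<Rightarrow> 'a set" where
  "generated i V j = (if (i, j) \<in> r then pre i j V else {})"

lemma compatible_generated:
  assumes "openin (X i) V" shows "compatible (generated i V)"
  unfolding compatible_def
proof (intro conjI ballI allI impI)
  show "openin (X j) (generated i V j)" for j
    using openin_pre[OF _ assms] by (auto simp: generated_def)
  show "pre j k (generated i V j) \<subseteq> generated i V k" if "(j, k) \<in> r" for j k
    using that index_trans[of i j k] bond_compose[of i j k] by (auto simp: generated_def)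
qed

lemma generated_self: "i \<in> I \<Longrightarrow> openin (X i) V \<Longrightarrow> generated i V i = V"
  using pre_self[of i V] index_refl openin_subset by (auto simp: generated_def)

lemma generated_subset:
  assumes "compatible W" "V \<subseteq> W i" shows "generated i V j \<subseteq> W j"
  using compatible_pre[OF assms(1), of i j] assms(2) by (auto simp: generated_def)

lemma UN_lpre_generated:
  assumes "i \<in> I" shows "(\<Union>j\<in>I. lpre j (generated i V j)) = lpre i V"
proof
  have "lpre j (generated i V j) \<subseteq> lpre i V" for j
    using limit_bond[of _ i j] by (auto simp: generated_def)
  then show "(\<Union>j\<in>I. lpre j (generated i V j)) \<subseteq> lpre i V" by blast
  have "lpre i V = lpre i (generated i V i)"
    using lpre_pre[OF index_refl[OF assms], of V] index_refl[OF assms] by (simp add: generated_def)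
  then show "lpre i V \<subseteq> (\<Union>j\<in>I. lpre j (generated i V j))" using assms by blast
qed

text \<open>The largest compatible family presenting a given open set.\<close>

definition core :: "('i \<Rightarrow> 'a) set \<Rightarrow> 'i \<Rightarrow> 'a set" where
  "core U i = \<Union>{V. openin (X i) V \<and> lpre i V \<subseteq> U}"

lemma openin_core: "openin (X i) (core U i)"
  unfolding core_def by blast

lemma lpre_core: "lpre i (core U i) \<subseteq> U"
  unfolding core_def by blast

lemma core_greatest: "openin (X i) V \<Longrightarrow> lpre i V \<subseteq> U \<Longrightarrow> V \<subseteq> core U i"
  unfolding core_def by blast

lemma compatible_core: "compatible (core U)"
  unfolding compatible_def
proof (intro conjI ballI allI impI openin_core)
  fix i j assume ij: "(i, j) \<in> r"
  show "pre i j (core U i) \<subseteq> core U j"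
    using lpre_core[of i U]
    by (intro core_greatest openin_pre[OF ij openin_core]) (simp only: lpre_pre[OF ij])
qed

lemma UN_lpre_core:
  assumes "openin L U" shows "(\<Union>i\<in>I. lpre i (core U i)) = U"
proof
  show "(\<Union>i\<in>I. lpre i (core U i)) \<subseteq> U" using lpre_core by blast
  show "U \<subseteq> (\<Union>i\<in>I. lpre i (core U i))"
  proof
    fix x assume x: "x \<in> U"
    then obtain i V where "i \<in> I" "openin (X i) V" "x i \<in> V" "lpre i V \<subseteq> U"
      using open_limit_basis[OF assms] by blast
    then show "x \<in> (\<Union>i\<in>I. lpre i (core U i))"
      using x openin_subset[OF assms] core_greatest[of i V U] by blast
  qed
qed

lemma core_mono: "U \<subseteq> V \<Longrightarrow> core U i \<subseteq> core V i"
  unfolding core_def by blast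

lemma core_Int: "core (U \<inter> V) i = core U i \<inter> core V i"
proof
  show "core U i \<inter> core V i \<subseteq> core (U \<inter> V) i"
    using lpre_core[of i U] lpre_core[of i V]
    by (intro core_greatest openin_Int openin_core) blast
qed (simp add: core_mono)

section \<open>Gluing compatible valuations\<close>

text \<open>A thread is an element of the projective limit of the spaces of valuations, up to the
  condition on the total mass.\<close>

definition thread :: "('i \<Rightarrow> 'a set \<Rightarrow> ennreal) \<Rightarrow> bool" where
  "thread \<nu> \<longleftrightarrow> (\<forall>i\<in>I. continuous_valuation (X i) (\<nu> i)) \<and>
    (\<forall>i j. (i, j) \<in> r \<longrightarrow> val_map (X j) (X i) (p i j) (\<nu> j) = \<nu> i)"

text \<open>The covering condition on which everything depends: the mass of \<open>V\<close> cannot be lost by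
  passing to a compatible family that covers the preimage of \<open>V\<close> in the limit.  It may fail in
  general because a limit can have too few points.\<close>

definition tight :: "('i \<Rightarrow> 'a set \<Rightarrow> ennreal) \<Rightarrow> bool" where
  "tight \<nu> \<longleftrightarrow> (\<forall>i V W. i \<in> I \<and> openin (X i) V \<and> compatible W \<and>
     lpre i V \<subseteq> (\<Union>j\<in>I. lpre j (W j)) \<longrightarrow> \<nu> i V \<le> (SUP j\<in>I. \<nu> j (W j)))"

lemma tightI:
  assumes "\<And>i V W c. i \<in> I \<Longrightarrow> openin (X i) V \<Longrightarrow> compatible W \<Longrightarrow>
    lpre i V \<subseteq> (\<Union>j\<in>I. lpre j (W j)) \<Longrightarrow> c < \<nu> i V \<Longrightarrow> \<exists>j\<in>I. c < \<nu> j (W j)"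
  shows "tight \<nu>"
  unfolding tight_def
proof (intro allI impI)
  fix i V W
  assume *: "i \<in> I \<and> openin (X i) V \<and> compatible W \<and> lpre i V \<subseteq> (\<Union>j\<in>I. lpre j (W j))"
  show "\<nu> i V \<le> (SUP j\<in>I. \<nu> j (W j))"
  proof (rule ccontr)
    assume "\<not> ?thesis"
    then obtain j where "j \<in> I" "(SUP j\<in>I. \<nu> j (W j)) < \<nu> j (W j)"
      using assms[of i V W "SUP j\<in>I. \<nu> j (W j)"] * by (auto simp: not_le)
    then show False
      using SUP_upper[of j I "\<lambda>j. \<nu> j (W j)"] by simp
  qed
qed

definition glue :: "('i \<Rightarrow> 'a set \<Rightarrow> ennreal) \<Rightarrow> ('i \<Rightarrow> 'a) set \<Rightarrow> ennreal" where
  "glue \<nu> = (\<lambda>U\<in>{U. openin L U}. SUP i\<in>I. \<nu> i (core U i))"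

lemma thread_valuation: "thread \<nu> \<Longrightarrow> i \<in> I \<Longrightarrow> continuous_valuation (X i) (\<nu> i)"
  by (simp add: thread_def)

lemma thread_pre:
  assumes "thread \<nu>" "(i, j) \<in> r" "openin (X i) V"
  shows "\<nu> j (pre i j V) = \<nu> i V"
proof -
  have "val_map (X j) (X i) (p i j) (\<nu> j) V = \<nu> i V"
    using assms(1,2) by (simp add: thread_def)
  then show ?thesis using assms(3) by simp
qed

lemma thread_mono:
  assumes "thread \<nu>" "compatible W" "(i, j) \<in> r"
  shows "\<nu> i (W i) \<le> \<nu> j (W j)"
proof -
  note ij = index_mem[OF assms(3)]
  have "\<nu> j (pre i j (W i)) \<le> \<nu> j (W j)"
    using assms ij
    by (intro continuous_valuation_mono[OF thread_valuation] openin_pre compatible_openin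
        compatible_pre)
  then show ?thesis
    using thread_pre[OF assms(1,3) compatible_openin[OF assms(2) ij(1)]] by simp
qed

text \<open>Under the covering condition the glued mass can be computed from any presentation, and then
  the axioms of a valuation need only be checked on convenient presentations.\<close>

lemma glue_presentation:
  assumes "thread \<nu>" "tight \<nu>" "compatible W"
  shows "glue \<nu> (\<Union>j\<in>I. lpre j (W j)) = (SUP j\<in>I. \<nu> j (W j))"
proof -
  let ?U = "\<Union>j\<in>I. lpre j (W j)"
  have "openin L ?U"
    using openin_lpre compatible_openin[OF assms(3)] by blast
  then have "glue \<nu> ?U = (SUP i\<in>I. \<nu> i (core ?U i))" by (simp add: glue_def)
  also have "\<dots> = (SUP j\<in>I. \<nu> j (W j))"
  proof (rule antisym)
    have "\<nu> i (core ?U i) \<le> (SUP j\<in>I. \<nu> j (W j))" if "i \<in> I" for i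
      using assms(2)[unfolded tight_def, rule_format, of i "core ?U i" W]
        that assms(3) lpre_core[of i ?U] openin_core[of i ?U] by simp
    then show "(SUP i\<in>I. \<nu> i (core ?U i)) \<le> (SUP j\<in>I. \<nu> j (W j))" by (rule SUP_least)
    have "W j \<subseteq> core ?U j" if "j \<in> I" for j
      using that compatible_openin[OF assms(3)] by (intro core_greatest) auto
    then have "\<nu> j (W j) \<le> \<nu> j (core ?U j)" if "j \<in> I" for j
      using that compatible_openin[OF assms(3)]
      by (intro continuous_valuation_mono[OF thread_valuation[OF assms(1)]] openin_core) auto
    then show "(SUP j\<in>I. \<nu> j (W j)) \<le> (SUP i\<in>I. \<nu> i (core ?U i))"
      by (intro SUP_mono) blast
  qed
  finally show ?thesis .
qed

lemma glue_lpre: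
  assumes "thread \<nu>" "tight \<nu>" "i \<in> I" "openin (X i) V"
  shows "glue \<nu> (lpre i V) = \<nu> i V"
proof -
  have "glue \<nu> (lpre i V) = (SUP j\<in>I. \<nu> j (generated i V j))"
    using glue_presentation[OF assms(1,2) compatible_generated[OF assms(4)]]
      UN_lpre_generated[OF assms(3)] by simp
  also have "\<dots> = \<nu> i V"
  proof (rule antisym)
    have "\<nu> j (generated i V j) \<le> \<nu> i V" if "j \<in> I" for j
      using continuous_valuation_empty[OF thread_valuation[OF assms(1) that]]
        thread_pre[OF assms(1) _ assms(4)] by (auto simp: generated_def)
    then show "(SUP j\<in>I. \<nu> j (generated i V j)) \<le> \<nu> i V" by (rule SUP_least)
    show "\<nu> i V \<le> (SUP j\<in>I. \<nu> j (generated i V j))"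
      using assms(3) generated_self[OF assms(3,4)] by (intro SUP_upper2[of i]) auto
  qed
  finally show ?thesis .
qed

lemma sum_SUP_thread:
  assumes "thread \<nu>" "compatible V" "compatible W"
  shows "(SUP i\<in>I. \<nu> i (V i) + \<nu> i (W i)) = (SUP i\<in>I. \<nu> i (V i)) + (SUP i\<in>I. \<nu> i (W i))"
proof (rule SUP_add_directed_ennreal)
  fix i j assume "i \<in> I" "j \<in> I"
  then obtain k where "(i, k) \<in> r" "(j, k) \<in> r" "k \<in> I" using index_upper_bound by blast
  then show "\<exists>k\<in>I. \<nu> i (V i) + \<nu> j (W j) \<le> \<nu> k (V k) + \<nu> k (W k)"
    using thread_mono[OF assms(1)] assms(2,3) by (intro bexI[of _ k] add_mono) auto
qed

lemma continuous_valuation_glue: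
  assumes \<nu>: "thread \<nu>" "tight \<nu>"
  shows "continuous_valuation L (glue \<nu>)"
  unfolding continuous_valuation_def
proof (intro conjI allI impI)
  have val: "glue \<nu> U = (SUP i\<in>I. \<nu> i (core U i))" if "openin L U" for U
    using that by (simp add: glue_def)
  show "glue \<nu> \<in> extensional {U. openin L U}"
    by (simp add: glue_def)
  obtain i where i: "i \<in> I" using index_nonempty by blast
  show "glue \<nu> {} = 0"
    using glue_lpre[OF \<nu> i, of "{}"] continuous_valuation_empty[OF thread_valuation[OF \<nu>(1) i]]
    by simp
  show "glue \<nu> U \<le> glue \<nu> V" if UV: "openin L U \<and> openin L V \<and> U \<subseteq> V" for U V
  proof -
    have "\<nu> i (core U i) \<le> \<nu> i (core V i)" if "i \<in> I" for i
      using UV by (intro continuous_valuation_mono[OF thread_valuation[OF \<nu>(1) that]]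
          openin_core core_mono) simp
    then have "(SUP i\<in>I. \<nu> i (core U i)) \<le> (SUP i\<in>I. \<nu> i (core V i))"
      by (intro SUP_mono) blast
    then show ?thesis using UV val by simp
  qed
  show "glue \<nu> U + glue \<nu> V = glue \<nu> (U \<union> V) + glue \<nu> (U \<inter> V)" if UV: "openin L U \<and> openin L V" for U V
  proof -
    have Un: "(\<Union>i\<in>I. lpre i (core U i \<union> core V i)) = U \<union> V"
      using UN_lpre_core[of U] UN_lpre_core[of V] UV by blast
    have "glue \<nu> U + glue \<nu> V = (SUP i\<in>I. \<nu> i (core U i) + \<nu> i (core V i))"
      using sum_SUP_thread[OF \<nu>(1) compatible_core compatible_core] UV val by simp
    also have "\<dots> = (SUP i\<in>I. \<nu> i (core U i \<union> core V i) + \<nu> i (core U i \<inter> core V i))"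
      using \<nu>(1) by (intro SUP_cong refl continuous_valuation_modular[OF thread_valuation] openin_core)
    also have "\<dots> = (SUP i\<in>I. \<nu> i (core U i \<union> core V i)) + (SUP i\<in>I. \<nu> i (core U i \<inter> core V i))"
      by (intro sum_SUP_thread[OF \<nu>(1)] compatible_Un compatible_Int compatible_core)
    also have "(SUP i\<in>I. \<nu> i (core U i \<union> core V i)) = glue \<nu> (U \<union> V)"
      using glue_presentation[OF \<nu> compatible_Un[OF compatible_core compatible_core], of U V] Un
      by simp
    also have "(SUP i\<in>I. \<nu> i (core U i \<inter> core V i)) = glue \<nu> (U \<inter> V)"
      using UV val[of "U \<inter> V"] by (simp add: core_Int openin_Int)
    finally show ?thesis .
  qed
  show "glue \<nu> (\<Union>D) = (SUP U\<in>D. glue \<nu> U)" if D: "directed_opens L D" for D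
  proof -
    have op: "openin L U" if "U \<in> D" for U using that D by (simp add: directed_opens_def)
    have ne: "D \<noteq> {}" using D by (simp add: directed_opens_def)
    have "(\<Union>i\<in>I. lpre i (\<Union>U\<in>D. core U i)) = (\<Union>U\<in>D. \<Union>i\<in>I. lpre i (core U i))" by blast
    also have "\<dots> = \<Union>D" using UN_lpre_core op by simp
    finally have "glue \<nu> (\<Union>D) = (SUP i\<in>I. \<nu> i (\<Union>U\<in>D. core U i))"
      using glue_presentation[OF \<nu> compatible_UN[of D core]] compatible_core by simp
    also have "\<dots> = (SUP i\<in>I. SUP U\<in>D. \<nu> i (core U i))"
    proof (intro SUP_cong refl)
      fix i assume i: "i \<in> I"
      show "\<nu> i (\<Union>U\<in>D. core U i) = (SUP U\<in>D. \<nu> i (core U i))"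
      proof (rule continuous_valuation_UN[OF thread_valuation[OF \<nu>(1) i] ne openin_core])
        fix U V assume "U \<in> D" "V \<in> D"
        then obtain W where "W \<in> D" "U \<subseteq> W" "V \<subseteq> W"
          using directed_opens_upper_bound[OF D] by blast
        then show "\<exists>W\<in>D. core U i \<subseteq> core W i \<and> core V i \<subseteq> core W i"
          by (intro bexI[of _ W] conjI core_mono)
      qed
    qed
    also have "\<dots> = (SUP U\<in>D. SUP i\<in>I. \<nu> i (core U i))" by (rule SUP_commute)
    also have "\<dots> = (SUP U\<in>D. glue \<nu> U)" using op val by (intro SUP_cong) simp_all
    finally show ?thesis .
  qed
qed

lemma val_map_glue:
  assumes \<nu>: "thread \<nu>" "tight \<nu>" and i: "i \<in> I"
  shows "val_map L (X i) (\<lambda>x. x i) (glue \<nu>) = \<nu> i"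
proof (rule continuous_valuation_eqI)
  show "continuous_valuation (X i) (val_map L (X i) (\<lambda>x. x i) (glue \<nu>))"
    by (intro continuous_valuation_val_map continuous_map_projection i continuous_valuation_glue \<nu>)
qed (use glue_lpre[OF \<nu> i] thread_valuation[OF \<nu>(1) i] in auto)

lemma glue_val_map:
  assumes \<mu>: "continuous_valuation L \<mu>"
  shows "glue (\<lambda>i\<in>I. val_map L (X i) (\<lambda>x. x i) \<mu>) = \<mu>"
proof (rule extensionalityI[of _ "{U. openin L U}"])
  fix U assume "U \<in> {U. openin L U}"
  then have U: "openin L U" by simp
  have "\<mu> U = \<mu> (\<Union>i\<in>I. lpre i (core U i))" by (simp add: UN_lpre_core[OF U])
  also have "\<dots> = (SUP i\<in>I. \<mu> (lpre i (core U i)))"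
  proof (rule continuous_valuation_UN[OF \<mu> index_nonempty])
    fix i j assume "i \<in> I" "j \<in> I"
    then obtain k where k: "(i, k) \<in> r" "(j, k) \<in> r" "k \<in> I" using index_upper_bound by blast
    have "lpre i (core U i) \<subseteq> lpre k (core U k)" if "(i, k) \<in> r" for i
      using compatible_pre[OF compatible_core that, of U] lpre_pre[OF that, of "core U i"] by blast
    then show "\<exists>k\<in>I. lpre i (core U i) \<subseteq> lpre k (core U k) \<and> lpre j (core U j) \<subseteq> lpre k (core U k)"
      using k by blast
  qed (simp add: openin_lpre openin_core)
  also have "\<dots> = glue (\<lambda>i\<in>I. val_map L (X i) (\<lambda>x. x i) \<mu>) U"
    using U by (simp add: glue_def openin_core)
  finally show "glue (\<lambda>i\<in>I. val_map L (X i) (\<lambda>x. x i) \<mu>) U = \<mu> U" by simp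
qed (use \<mu> in \<open>simp_all add: glue_def continuous_valuation_def\<close>)

lemma projective_system_val_space:
  "projective_system I r (\<lambda>i. val_space T (X i)) (\<lambda>i j. val_map (X j) (X i) (p i j))"
  unfolding projective_system_def
proof (intro conjI allI impI ballI)
  show "directed_preorder_on I r" by (rule directed_index)
  show "continuous_map (val_space T (X j)) (val_space T (X i)) (val_map (X j) (X i) (p i j))"
    if "(i, j) \<in> r" for i j
    by (intro continuous_map_val_map bond_continuous that)
  show "val_map (X i) (X i) (p i i) \<nu> = \<nu>" if "i \<in> I" "\<nu> \<in> topspace (val_space T (X i))" for i \<nu>
    using that bond_id by (intro val_map_id) (auto simp: topspace_val_space)
  show "val_map (X j) (X i) (p i j) (val_map (X k) (X j) (p j k) \<nu>) = val_map (X k) (X i) (p i k) \<nu>"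
    if "(i, j) \<in> r \<and> (j, k) \<in> r" for i j k \<nu>
    using that bond_compose by (intro val_map_compose bond_continuous) auto
qed

text \<open>Gluing is inverse to taking images under the projections. It is continuous because the glued
  mass of \<open>U\<close> exceeds \<open>c\<close> exactly when some \<open>\<nu> i (core U i)\<close> does.\<close>

theorem projective_limit_val_space:
  assumes tight: "\<And>\<nu>. thread \<nu> \<Longrightarrow> tight \<nu>"
  shows "is_proj_lim I r (\<lambda>i. val_space T (X i)) (\<lambda>i j. val_map (X j) (X i) (p i j))
    (val_space T L) (\<lambda>i. val_map L (X i) (\<lambda>x. x i))"
proof -
  interpret V: projective_sys I r "\<lambda>i. val_space T (X i)" "\<lambda>i j. val_map (X j) (X i) (p i j)"
    by unfold_locales (rule projective_system_val_space)
  let ?F = "\<lambda>\<mu>. \<lambda>i\<in>I. val_map L (X i) (\<lambda>x. x i) \<mu>"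
  have in_V: "\<nu> i \<in> topspace (val_space T (X i))" if "\<nu> \<in> topspace V.L" "i \<in> I" for \<nu> i
    using V.limit_mem[OF that] .
  have thread: "thread \<nu>" if "\<nu> \<in> topspace V.L" for \<nu>
    unfolding thread_def using in_V[OF that] V.limit_bond[OF that] by (auto simp: topspace_val_space)
  have F_in: "?F \<mu> \<in> topspace V.L" if \<mu>: "\<mu> \<in> topspace (val_space T L)" for \<mu>
    unfolding V.topspace_limit mem_Collect_eq
  proof (intro conjI allI impI)
    show "?F \<mu> \<in> (\<Pi>\<^sub>E i\<in>I. topspace (val_space T (X i)))"
      using val_map_in_val_space[OF continuous_map_projection \<mu>] by auto
    show "val_map (X j) (X i) (p i j) (?F \<mu> j) = ?F \<mu> i" if ij: "(i, j) \<in> r" for i j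
      using index_mem[OF ij] limit_bond[OF _ ij]
      by (simp add: val_map_compose[OF continuous_map_projection bond_continuous[OF ij]])
  qed
  have mass: "glue \<nu> (topspace L) = \<nu> i (topspace (X i))" if "thread \<nu>" "i \<in> I" for \<nu> i
  proof -
    have "lpre i (topspace (X i)) = topspace L" using limit_mem that(2) by auto
    then show ?thesis using glue_lpre[OF that(1) tight[OF that(1)] that(2) openin_topspace] by simp
  qed
  have "homeomorphic_maps (val_space T L) V.L ?F glue"
    unfolding homeomorphic_maps_def
  proof (intro conjI ballI)
    have "continuous_map (val_space T L) (product_topology (\<lambda>i. val_space T (X i)) I) ?F"
      unfolding continuous_map_componentwise
      using continuous_map_val_map[OF continuous_map_projection] by auto
    then show "continuous_map (val_space T L) V.L ?F"
      using F_in unfolding proj_lim_def continuous_map_in_subtopology by auto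
    show "glue (?F \<mu>) = \<mu>" if "\<mu> \<in> topspace (val_space T L)" for \<mu>
      using that by (intro glue_val_map) (simp add: topspace_val_space)
    show "?F (glue \<nu>) = \<nu>" if "\<nu> \<in> topspace V.L" for \<nu>
    proof (rule extensionalityI[of _ I])
      show "\<nu> \<in> extensional I" using that unfolding V.topspace_limit PiE_def by blast
    qed (use val_map_glue[OF thread[OF that] tight[OF thread[OF that]]] in auto)
    show "continuous_map V.L (val_space T L) glue"
    proof (rule continuous_map_into_val_space)
      show "glue \<nu> \<in> topspace (val_space T L)" if "\<nu> \<in> topspace V.L" for \<nu>
      proof -
        obtain i where i: "i \<in> I" using index_nonempty by blast
        show ?thesis
          using continuous_valuation_glue[OF thread[OF that] tight[OF thread[OF that]]]
            mass[OF thread[OF that] i] in_V[OF that i] by (simp add: topspace_val_space)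
      qed
      fix U and c :: real assume U: "openin L U" and c: "0 \<le> c"
      have "{\<nu> \<in> topspace V.L. ennreal c < glue \<nu> U} = (\<Union>i\<in>I. {\<nu> \<in> topspace V.L.
          \<nu> i \<in> {\<mu> \<in> topspace (val_space T (X i)). ennreal c < \<mu> (core U i)}})"
        using U in_V by (auto simp: glue_def less_SUP_iff)
      also have "openin V.L \<dots>"
        by (intro openin_Union ballI)
          (use V.openin_lpre[OF _ openin_val_space_greater[OF openin_core c]] in blast)
      finally show "openin V.L {\<nu> \<in> topspace V.L. ennreal c < glue \<nu> U}" .
    qed
  qed
  then show ?thesis
    unfolding is_proj_lim_def homeomorphic_map_maps by blast
qed

end

section \<open>Points of a limit of sober spaces\<close>

text \<open>In lattice terms, sobriety says that every prime open set is the complement of the closure of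
  a point.\<close>

lemma sober_prime_open:
  assumes "sober_space Y" "openin Y U" "U \<noteq> topspace Y"
    and prime: "\<And>A B. openin Y A \<Longrightarrow> openin Y B \<Longrightarrow> A \<inter> B \<subseteq> U \<Longrightarrow> A \<subseteq> U \<or> B \<subseteq> U"
  obtains x where "x \<in> topspace Y" "\<And>A. openin Y A \<Longrightarrow> x \<in> A \<longleftrightarrow> \<not> A \<subseteq> U"
proof -
  let ?C = "topspace Y - U"
  have U: "U \<subseteq> topspace Y" using assms(2) openin_subset by blast
  have "irreducible_closedin Y ?C"
    unfolding irreducible_closedin_def
  proof (intro conjI allI impI)
    show "closedin Y ?C" using assms(2) by blast
    show "?C \<noteq> {}" using assms(3) U by blast
    fix A B assume AB: "closedin Y A \<and> closedin Y B \<and> ?C \<subseteq> A \<union> B"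
    then have "topspace Y - A \<subseteq> U \<or> topspace Y - B \<subseteq> U"
      by (intro prime openin_diff openin_topspace) auto
    then show "?C \<subseteq> A \<or> ?C \<subseteq> B" by blast
  qed
  then obtain x where x: "x \<in> topspace Y" "?C = Y closure_of {x}"
    using assms(1) unfolding sober_space_def by blast
  have "x \<in> A \<longleftrightarrow> \<not> A \<subseteq> U" if A: "openin Y A" for A
    using openin_Int_closure_of_eq_empty[OF A, of "{x}"] openin_subset[OF A] x(2) by blast
  then show ?thesis using that x(1) by blast
qed

lemma t0_space_eqI:
  assumes "t0_space Y" "x \<in> topspace Y" "y \<in> topspace Y"
    and "\<And>U. openin Y U \<Longrightarrow> x \<in> U \<longleftrightarrow> y \<in> U"
  shows "x = y"
  using assms unfolding t0_space_def by blast

context projective_sys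
begin

lemma compatible_cong:
  assumes "\<And>i. i \<in> I \<Longrightarrow> V i = W i" shows "compatible V \<longleftrightarrow> compatible W"
proof -
  have "pre i j (V i) \<subseteq> V j \<longleftrightarrow> pre i j (W i) \<subseteq> W j" if "(i, j) \<in> r" for i j
    using assms[OF index_mem(1)[OF that]] assms[OF index_mem(2)[OF that]] by simp
  then show ?thesis using assms by (simp add: compatible_def)
qed

text \<open>If the spaces are sober, then the limit has enough points to separate a compatible family
  from a Scott-open filter \<open>good\<close> of such families: a family that is maximal among those containing
  \<open>W\<close> and outside the filter is prime, so each of its components is the complement of the closure
  of a point, and these points are the coordinates of a point of the limit.  The condition \<open>top\<close>
  expresses that restricting a family to the indices above \<open>i\<close> does not change the open set that
  it presents.\<close>

lemma limit_point_outside: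
  fixes good :: "('i \<Rightarrow> 'a set) \<Rightarrow> bool"
  assumes sober: "\<And>i. i \<in> I \<Longrightarrow> sober_space (X i)"
    and up: "\<And>V W. compatible V \<Longrightarrow> compatible W \<Longrightarrow> good V \<Longrightarrow> (\<And>i. i \<in> I \<Longrightarrow> V i \<subseteq> W i) \<Longrightarrow> good W"
    and inter: "\<And>V W. compatible V \<Longrightarrow> compatible W \<Longrightarrow> good V \<Longrightarrow> good W \<Longrightarrow> good (\<lambda>i. V i \<inter> W i)"
    and scott: "\<And>C. C \<noteq> {} \<Longrightarrow> (\<And>W. W \<in> C \<Longrightarrow> compatible W) \<Longrightarrow>
      (\<And>V W. V \<in> C \<Longrightarrow> W \<in> C \<Longrightarrow> \<exists>Z\<in>C. \<forall>i. V i \<subseteq> Z i \<and> W i \<subseteq> Z i) \<Longrightarrow>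
      good (\<lambda>i. \<Union>W\<in>C. W i) \<Longrightarrow> \<exists>W\<in>C. good W"
    and top: "\<And>i. i \<in> I \<Longrightarrow> good (generated i (topspace (X i)))"
    and W: "compatible W" "\<not> good W"
  obtains x where "x \<in> topspace L" "\<And>i. i \<in> I \<Longrightarrow> x i \<notin> W i"
    "\<And>i A. i \<in> I \<Longrightarrow> openin (X i) A \<Longrightarrow> good (generated i A) \<Longrightarrow> x i \<in> A"
proof -
  \<comment> \<open>Families are encoded as relations, so that inclusion of families becomes inclusion of sets.\<close>
  define \<A> where "\<A> = {R. compatible (\<lambda>i. R `` {i}) \<and> \<not> good (\<lambda>i. R `` {i}) \<and> Sigma I W \<subseteq> R}"
  have sect: "Sigma I V `` {i} = V i" if "i \<in> I" for V :: "'i \<Rightarrow> 'a set" and i using that by auto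
  have "compatible (\<lambda>i. Sigma I W `` {i})"
    using W(1) compatible_cong[of "\<lambda>i. Sigma I W `` {i}" W] sect by blast
  moreover from this have "\<not> good (\<lambda>i. Sigma I W `` {i})"
    using up[OF _ W(1)] W(2) sect by blast
  ultimately have "Sigma I W \<in> \<A>" by (simp add: \<A>_def)
  moreover have "\<Union>\<C> \<in> \<A>" if ne: "\<C> \<noteq> {}" and chain: "subset.chain \<A> \<C>" for \<C>
  proof -
    have mem: "R \<in> \<A>" if "R \<in> \<C>" for R using chain that by (auto simp: subset.chain_def)
    define C where "C = (\<lambda>R i. R `` {i}) ` \<C>"
    have eq: "(\<lambda>i. (\<Union>\<C>) `` {i}) = (\<lambda>i. \<Union>V\<in>C. V i)" by (auto simp: C_def fun_eq_iff)
    have comp: "compatible V" if "V \<in> C" for V using that mem by (auto simp: C_def \<A>_def)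
    have "\<not> good (\<lambda>i. \<Union>V\<in>C. V i)"
    proof
      assume g: "good (\<lambda>i. \<Union>V\<in>C. V i)"
      have "\<exists>V\<in>C. good V"
      proof (rule scott[OF _ comp _ g])
        show "C \<noteq> {}" using ne by (simp add: C_def)
        fix V V' assume "V \<in> C" "V' \<in> C"
        then obtain R R' where R: "R \<in> \<C>" "R' \<in> \<C>" "V = (\<lambda>i. R `` {i})" "V' = (\<lambda>i. R' `` {i})"
          by (auto simp: C_def)
        then have "R \<subseteq> R' \<or> R' \<subseteq> R" using chain by (auto simp: subset.chain_def)
        then have "(\<forall>i. V i \<subseteq> V' i) \<or> (\<forall>i. V' i \<subseteq> V i)" unfolding R(3,4) by auto
        then show "\<exists>Z\<in>C. \<forall>i. V i \<subseteq> Z i \<and> V' i \<subseteq> Z i"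
          using bexI[OF _ \<open>V \<in> C\<close>] bexI[OF _ \<open>V' \<in> C\<close>] by (elim disjE) simp_all
      qed
      then show False using mem by (auto simp: C_def \<A>_def)
    qed
    moreover have "compatible (\<lambda>i. \<Union>V\<in>C. V i)" using comp by (rule compatible_UN)
    moreover have "Sigma I W \<subseteq> \<Union>\<C>" using ne mem by (auto simp: \<A>_def)
    ultimately show ?thesis unfolding \<A>_def by (simp only: mem_Collect_eq eq) simp
  qed
  ultimately obtain M where M: "M \<in> \<A>" and max: "\<And>R. R \<in> \<A> \<Longrightarrow> M \<subseteq> R \<Longrightarrow> R = M"
    using subset_Zorn_nonempty[of \<A>] by blast
  define U where "U = (\<lambda>i. M `` {i})"
  have U: "compatible U" "\<not> good U" "\<And>i. i \<in> I \<Longrightarrow> W i \<subseteq> U i"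
    using M by (auto simp: \<A>_def U_def)
  have U_max: "good (\<lambda>i. U i \<union> V i)" if V: "compatible V" and i: "i \<in> I" "\<not> V i \<subseteq> U i" for V i
  proof (rule ccontr)
    assume bad: "\<not> good (\<lambda>i. U i \<union> V i)"
    let ?R = "M \<union> Sigma I V"
    have sec: "?R `` {j} = U j \<union> V j" if "j \<in> I" for j using that by (auto simp: U_def)
    have comp: "compatible (\<lambda>j. ?R `` {j})"
      using compatible_Un[OF U(1) V] compatible_cong[of "\<lambda>j. ?R `` {j}" "\<lambda>j. U j \<union> V j"] sec
      by blast
    moreover have "\<not> good (\<lambda>j. ?R `` {j})"
      using up[OF comp compatible_Un[OF U(1) V]] bad sec by blast
    moreover have "Sigma I W \<subseteq> ?R" using M by (auto simp: \<A>_def)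
    ultimately have "?R \<in> \<A>" by (simp add: \<A>_def)
    then have "?R = M" using max by blast
    then show False using i sec[OF i(1)] by (auto simp: U_def)
  qed
  have small: "A \<subseteq> U i" if i: "i \<in> I" "openin (X i) A" "(i, k) \<in> r" "pre i k A \<subseteq> U k" for i k A
  proof (rule ccontr)
    assume "\<not> A \<subseteq> U i"
    then have "good (\<lambda>j. U j \<union> generated i A j)"
      using U_max[OF compatible_generated[OF i(2)] i(1)] generated_self[OF i(1,2)] by simp
    then have g: "good (\<lambda>j. (U j \<union> generated i A j) \<inter> generated k (topspace (X k)) j)"
      by (intro inter compatible_Un U compatible_generated top i index_mem[OF i(3)] openin_topspace)
    have "(U j \<union> generated i A j) \<inter> generated k (topspace (X k)) j \<subseteq> U j" for j
    proof (cases "(k, j) \<in> r")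
      case True
      then have "generated i A j = pre k j (pre i k A)"
        using index_trans[OF i(3) True] pre_pre[OF i(3) True] by (simp add: generated_def)
      also have "\<dots> \<subseteq> U j" using compatible_pre[OF U(1) True] i(4) by auto
      finally show ?thesis by auto
    qed (simp add: generated_def)
    then have "good U"
      using up[OF _ U(1) g] compatible_Int[OF compatible_Un[OF U(1) compatible_generated[OF i(2)]]
          compatible_generated[OF openin_topspace]] by blast
    then show False using U(2) by blast
  qed
  have prime: "A \<subseteq> U i \<or> B \<subseteq> U i"
    if i: "i \<in> I" and AB: "openin (X i) A" "openin (X i) B" "A \<inter> B \<subseteq> U i" for i A B
  proof (rule ccontr)
    assume "\<not> ?thesis"
    then have g: "good (\<lambda>j. (U j \<union> generated i A j) \<inter> (U j \<union> generated i B j))"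
      using U_max[OF compatible_generated i] AB generated_self[OF i]
      by (intro inter compatible_Un U compatible_generated) auto
    have "(U j \<union> generated i A j) \<inter> (U j \<union> generated i B j) \<subseteq> U j" for j
      using generated_subset[OF U(1) AB(3), of j] by (auto simp: generated_def)
    then have "good U"
      using up[OF _ U(1) g] compatible_Int compatible_Un U(1) compatible_generated AB(1,2) by blast
    then show False using U(2) by blast
  qed
  have proper: "U i \<noteq> topspace (X i)" if i: "i \<in> I" for i
  proof
    assume "U i = topspace (X i)"
    then have "generated i (topspace (X i)) j \<subseteq> U j" for j
      using generated_subset[OF U(1)] by simp
    then have "good U"
      using up[OF compatible_generated[OF openin_topspace] U(1) top[OF i]] by blast
    then show False using U(2) by blast
  qed
  have "\<exists>x. x \<in> topspace (X i) \<and> (\<forall>A. openin (X i) A \<longrightarrow> x \<in> A \<longleftrightarrow> \<not> A \<subseteq> U i)" if "i \<in> I" for i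
    by (rule sober_prime_open[OF sober[OF that] compatible_openin[OF U(1) that] proper[OF that]])
      (use prime[OF that] in blast)+
  then obtain x where x: "\<And>i. i \<in> I \<Longrightarrow> x i \<in> topspace (X i)"
    "\<And>i A. i \<in> I \<Longrightarrow> openin (X i) A \<Longrightarrow> x i \<in> A \<longleftrightarrow> \<not> A \<subseteq> U i"
    by metis
  have bond: "p i j (x j) = x i" if ij: "(i, j) \<in> r" for i j
  proof (rule t0_space_eqI)
    note ind = index_mem[OF ij]
    show "t0_space (X i)" using sober[OF ind(1)] by (simp add: sober_space_def)
    show "p i j (x j) \<in> topspace (X i)" "x i \<in> topspace (X i)"
      using bond_mem[OF ij] x(1) ind by auto
    show "p i j (x j) \<in> A \<longleftrightarrow> x i \<in> A" if A: "openin (X i) A" for A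
    proof -
      have "p i j (x j) \<in> A \<longleftrightarrow> x j \<in> pre i j A" using x(1)[OF ind(2)] by simp
      also have "\<dots> \<longleftrightarrow> \<not> pre i j A \<subseteq> U j" by (rule x(2)[OF ind(2) openin_pre[OF ij A]])
      also have "\<dots> \<longleftrightarrow> \<not> A \<subseteq> U i"
        using small[OF ind(1) A ij] compatible_pre[OF U(1) ij] by auto
      finally show ?thesis using x(2)[OF ind(1) A] by simp
    qed
  qed
  let ?x = "restrict x I"
  have "?x \<in> topspace L"
    unfolding topspace_limit using x(1) bond index_mem by auto
  moreover have "?x i \<notin> W i" if "i \<in> I" for i
    using x(2)[OF that compatible_openin[OF W(1) that]] U(3)[OF that] that by simp
  moreover have "?x i \<in> A" if i: "i \<in> I" and A: "openin (X i) A" "good (generated i A)" for i A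
  proof -
    have "\<not> A \<subseteq> U i"
      using up[OF compatible_generated[OF A(1)] U(1) A(2)] generated_subset[OF U(1)] U(2) by blast
    then show ?thesis using x(2)[OF i A(1)] i by simp
  qed
  ultimately show ?thesis using that by blast
qed

text \<open>The version used below: the filters live on the spaces of a cofinal subsystem.  It extends
  Steenrod's theorem that a projective limit of nonempty compact sober spaces is nonempty.\<close>

lemma limit_point_of_scott_filters:
  fixes K :: "'k set" and s :: "'k \<Rightarrow> 'i" and F :: "'k \<Rightarrow> 'a set set"
  assumes sober: "\<And>i. i \<in> I \<Longrightarrow> sober_space (X i)"
    and s: "\<And>k. k \<in> K \<Longrightarrow> s k \<in> I" "\<And>i. i \<in> I \<Longrightarrow> \<exists>k\<in>K. (i, s k) \<in> r"
    and F: "\<And>k. k \<in> K \<Longrightarrow> scott_open_family (X (s k)) (F k)"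
      "\<And>k. k \<in> K \<Longrightarrow> topspace (X (s k)) \<in> F k"
      "\<And>k U V. k \<in> K \<Longrightarrow> U \<in> F k \<Longrightarrow> V \<in> F k \<Longrightarrow> U \<inter> V \<in> F k"
    and dir: "\<And>k k'. k \<in> K \<Longrightarrow> k' \<in> K \<Longrightarrow> \<exists>l\<in>K. (s k, s l) \<in> r \<and> (s k', s l) \<in> r \<and>
      pre (s k) (s l) ` F k \<subseteq> F l \<and> pre (s k') (s l) ` F k' \<subseteq> F l"
    and W: "compatible W" "\<And>k. k \<in> K \<Longrightarrow> W (s k) \<notin> F k"
  obtains x where "x \<in> topspace L" "\<And>i. i \<in> I \<Longrightarrow> x i \<notin> W i"
    "\<And>k A. k \<in> K \<Longrightarrow> A \<in> F k \<Longrightarrow> x (s k) \<in> A"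
proof -
  define good where "good V \<longleftrightarrow> (\<exists>k\<in>K. V (s k) \<in> F k)" for V
  have F_up: "V \<in> F k" if "k \<in> K" "U \<in> F k" "openin (X (s k)) V" "U \<subseteq> V" for k U V
    using F(1)[OF that(1)] that(2-4) unfolding scott_open_family_def by blast
  have F_open: "openin (X (s k)) U" if "k \<in> K" "U \<in> F k" for k U
    using F(1)[OF that(1)] that(2) unfolding scott_open_family_def by blast
  show ?thesis
  proof (rule limit_point_outside[of good W])
    show "sober_space (X i)" if "i \<in> I" for i by (rule sober[OF that])
    show "good W'" if VW: "compatible V" "compatible W'" "good V" "\<And>i. i \<in> I \<Longrightarrow> V i \<subseteq> W' i" for V W'
    proof -
      obtain k where k: "k \<in> K" "V (s k) \<in> F k" using VW(3) by (auto simp: good_def)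
      then have "W' (s k) \<in> F k"
        using F_up[OF k] compatible_openin[OF VW(2) s(1)] VW(4)[OF s(1)] by blast
      then show ?thesis using k(1) by (auto simp: good_def)
    qed
    show "good (\<lambda>i. V i \<inter> W' i)" if VW: "compatible V" "compatible W'" "good V" "good W'" for V W'
    proof -
      obtain k k' where k: "k \<in> K" "V (s k) \<in> F k" "k' \<in> K" "W' (s k') \<in> F k'"
        using VW(3,4) by (auto simp: good_def)
      then obtain l where l: "l \<in> K" "(s k, s l) \<in> r" "(s k', s l) \<in> r"
        "pre (s k) (s l) ` F k \<subseteq> F l" "pre (s k') (s l) ` F k' \<subseteq> F l"
        using dir[of k k'] by blast
      have "V (s l) \<in> F l"
        using F_up[OF l(1) _ compatible_openin[OF VW(1) s(1)[OF l(1)]] compatible_pre[OF VW(1) l(2)]]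
          l(4) k(2) by blast
      moreover have "W' (s l) \<in> F l"
        using F_up[OF l(1) _ compatible_openin[OF VW(2) s(1)[OF l(1)]] compatible_pre[OF VW(2) l(3)]]
          l(5) k(4) by blast
      ultimately show ?thesis using F(3) l(1) by (auto simp: good_def)
    qed
    show "\<exists>V\<in>C. good V" if C: "C \<noteq> {}" "\<And>V. V \<in> C \<Longrightarrow> compatible V"
      "\<And>V V'. V \<in> C \<Longrightarrow> V' \<in> C \<Longrightarrow> \<exists>Z\<in>C. \<forall>i. V i \<subseteq> Z i \<and> V' i \<subseteq> Z i"
      "good (\<lambda>i. \<Union>V\<in>C. V i)" for C
    proof -
      obtain k where k: "k \<in> K" "(\<Union>V\<in>C. V (s k)) \<in> F k" using C(4) by (auto simp: good_def)
      have "directed_opens (X (s k)) ((\<lambda>V. V (s k)) ` C)"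
        unfolding directed_opens_def
      proof (intro conjI ballI)
        show "(\<lambda>V. V (s k)) ` C \<noteq> {}" using C(1) by simp
        show "openin (X (s k)) A" if "A \<in> (\<lambda>V. V (s k)) ` C" for A
          using that compatible_openin[OF C(2) s(1)[OF k(1)]] by blast
        fix A B assume "A \<in> (\<lambda>V. V (s k)) ` C" "B \<in> (\<lambda>V. V (s k)) ` C"
        then obtain V V' where V: "V \<in> C" "A = V (s k)" "V' \<in> C" "B = V' (s k)" by blast
        obtain Z where "Z \<in> C" "\<forall>i. V i \<subseteq> Z i \<and> V' i \<subseteq> Z i" using C(3)[OF V(1,3)] by blast
        then show "\<exists>Z\<in>(\<lambda>V. V (s k)) ` C. A \<subseteq> Z \<and> B \<subseteq> Z" using V by blast
      qed
      then have "\<exists>A\<in>(\<lambda>V. V (s k)) ` C. A \<in> F k"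
        using F(1)[OF k(1)] k(2) unfolding scott_open_family_def by blast
      then show ?thesis using k(1) by (auto simp: good_def)
    qed
    show "good (generated i (topspace (X i)))" if i: "i \<in> I" for i
    proof -
      obtain k where k: "k \<in> K" "(i, s k) \<in> r" using s(2)[OF i] by blast
      have "generated i (topspace (X i)) (s k) = topspace (X (s k))"
        using k(2) bond_mem[OF k(2)] by (auto simp: generated_def)
      then show ?thesis
        using F(2)[OF k(1)] k(1) unfolding good_def by (intro bexI[of _ k]) simp_all
    qed
    show "compatible W" by (rule W(1))
    show "\<not> good W" using W(2) by (auto simp: good_def)
    fix x assume x: "x \<in> topspace L" "\<And>i. i \<in> I \<Longrightarrow> x i \<notin> W i"
      "\<And>i A. i \<in> I \<Longrightarrow> openin (X i) A \<Longrightarrow> good (generated i A) \<Longrightarrow> x i \<in> A"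
    have "x (s k) \<in> A" if k: "k \<in> K" "A \<in> F k" for k A
    proof -
      have "good (generated (s k) A)"
        using generated_self[OF s(1)[OF k(1)] F_open[OF k]] k
        unfolding good_def by (intro bexI[of _ k]) simp_all
      then show ?thesis by (rule x(3)[OF s(1)[OF k(1)] F_open[OF k]])
    qed
    then show thesis using that x(1,2) by blast
  qed
qed

section \<open>Systems of embedding-projection pairs\<close>

text \<open>Here every space of the system embeds into the limit, so the covering condition can be
  checked inside a single space: the preimages of the sets \<open>W j\<close> under the embeddings \<open>e i j\<close> form a
  directed cover of \<open>V\<close>, and \<open>e i j \<circ> p i j \<le> id\<close> bounds their masses.\<close>

lemma tight_ep_system:
  assumes ep: "ep_system I r X p" and \<nu>: "thread \<nu>"
  shows "tight \<nu>"
proof (rule tightI)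
  obtain e :: "'i \<Rightarrow> 'i \<Rightarrow> 'a \<Rightarrow> 'a" where
    e_pair: "\<forall>i j. (i, j) \<in> r \<longrightarrow> continuous_map (X i) (X j) (e i j) \<and>
      (\<forall>x\<in>topspace (X i). p i j (e i j x) = x) \<and>
      (\<forall>y\<in>topspace (X j). spec_le (X j) (e i j (p i j y)) y)" and
    e_id: "\<forall>i\<in>I. \<forall>x\<in>topspace (X i). e i i x = x" and
    e_comp: "\<forall>i j k. (i, j) \<in> r \<and> (j, k) \<in> r \<longrightarrow>
      (\<forall>x\<in>topspace (X i). e j k (e i j x) = e i k x)"
    using ep unfolding ep_system_def by (elim conjE exE) (rule that)
  have e: "\<And>i j. (i, j) \<in> r \<Longrightarrow> continuous_map (X i) (X j) (e i j)"
    "\<And>i j x. (i, j) \<in> r \<Longrightarrow> x \<in> topspace (X i) \<Longrightarrow> p i j (e i j x) = x"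
    "\<And>i j y. (i, j) \<in> r \<Longrightarrow> y \<in> topspace (X j) \<Longrightarrow> spec_le (X j) (e i j (p i j y)) y"
    using e_pair by simp_all
  have e_trans: "e j k (e i j x) = e i k x"
    if "(i, j) \<in> r" "(j, k) \<in> r" "x \<in> topspace (X i)" for i j k x
    using e_comp that by simp
  have e_mem: "e i j x \<in> topspace (X j)" if "(i, j) \<in> r" "x \<in> topspace (X i)" for i j x
    using continuous_map_image_subset_topspace[OF e(1)[OF that(1)]] that(2) by blast
  fix i V W c
  assume i: "i \<in> I" and V: "openin (X i) V" and W: "compatible W"
    and cover: "lpre i V \<subseteq> (\<Union>j\<in>I. lpre j (W j))" and c: "c < \<nu> i V"
  have V_sub: "V \<subseteq> topspace (X i)" using V openin_subset by blast
  let ?J = "{j. (i, j) \<in> r}"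
  let ?A = "\<lambda>j. V \<inter> {y \<in> topspace (X i). e i j y \<in> W j}"
  have A_open: "openin (X i) (?A j)" if "j \<in> ?J" for j
    using that compatible_openin[OF W index_mem(2)]
    by (intro openin_Int V openin_continuous_map_preimage[OF e(1)]) auto
  have A_mono: "?A j \<subseteq> ?A k" if "(i, j) \<in> r" "(j, k) \<in> r" for j k
  proof
    fix y assume y: "y \<in> ?A j"
    have ik: "(i, k) \<in> r" using index_trans that by blast
    have "p j k (e i k y) = e i j y"
      using e(2)[OF that(2) e_mem[OF that(1)]] e_trans[OF that] y by auto
    then have "e i k y \<in> pre j k (W j)" using y e_mem[OF ik] by auto
    then show "y \<in> ?A k" using compatible_pre[OF W that(2)] y by auto
  qed
  have A_cover: "\<exists>k\<in>?J. y \<in> ?A k" if y: "y \<in> V" for y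
  proof -
    have yX: "y \<in> topspace (X i)" using y V_sub by blast
    \<comment> \<open>The image of \<open>y\<close> under the embedding of \<open>X i\<close> into the limit; its coordinates do not depend
      on the chosen upper bounds.\<close>
    define b where "b j = (SOME k. (i, k) \<in> r \<and> (j, k) \<in> r)" for j
    have b: "(i, b j) \<in> r \<and> (j, b j) \<in> r" if "j \<in> I" for j
    proof -
      have "\<exists>k. (i, k) \<in> r \<and> (j, k) \<in> r" using index_upper_bound[OF i that] by blast
      then show ?thesis unfolding b_def by (rule someI_ex)
    qed
    define z where "z = (\<lambda>j\<in>I. p j (b j) (e i (b j) y))"
    have step: "p j l (e i l y) = p j k (e i k y)"
      if "(i, k) \<in> r" "(j, k) \<in> r" "(k, l) \<in> r" for j k l
    proof -
      have il: "(i, l) \<in> r" using index_trans that by blast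
      have "p j l (e i l y) = p j k (p k l (e i l y))"
        using bond_compose[OF that(2,3) e_mem[OF il yX]] by simp
      also have "p k l (e i l y) = e i k y"
        using e(2)[OF that(3) e_mem[OF that(1) yX]] e_trans[OF that(1,3) yX] by simp
      finally show ?thesis .
    qed
    have z: "z j = p j k (e i k y)" if jk: "(i, k) \<in> r" "(j, k) \<in> r" for j k
    proof -
      have j: "j \<in> I" using index_mem jk by blast
      have "k \<in> I" "b j \<in> I"
        using index_mem(2)[OF jk(1)] index_mem(2)[of i "b j"] b[OF j] by simp_all
      then obtain l where "(k, l) \<in> r" "(b j, l) \<in> r" by (rule index_upper_bound)
      then show ?thesis using step[OF jk, of l] step[of "b j" j l] b[OF j] j by (simp add: z_def)
    qed
    have z_above: "z j = e i j y" if "(i, j) \<in> r" for j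
      using z[OF that index_refl] bond_id e_mem[OF that yX] index_mem[OF that] by simp
    have "z \<in> topspace L"
      unfolding topspace_limit mem_Collect_eq
    proof (intro conjI allI impI)
      show "z \<in> (\<Pi>\<^sub>E j\<in>I. topspace (X j))"
        using b e_mem[OF _ yX] bond_mem by (auto simp: z_def)
      fix j k assume jk: "(j, k) \<in> r"
      then have k: "k \<in> I" using index_mem by blast
      have "p j k (z k) = p j (b k) (e i (b k) y)"
        using z[of "b k" k] b[OF k] bond_compose[OF jk _ e_mem[OF _ yX], of "b k"] by simp
      also have "\<dots> = z j"
        using z[of "b k" j] b[OF k] index_trans[OF jk] by simp
      finally show "p j k (z k) = z j" .
    qed
    moreover have "z i = y" using z_above[OF index_refl[OF i]] e_id i yX by simp
    ultimately obtain j where j: "j \<in> I" "z j \<in> W j" "z \<in> topspace L"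
      using cover y by blast
    obtain k where k: "(i, k) \<in> r" "(j, k) \<in> r" using index_upper_bound[OF i j(1)] by blast
    have "z k \<in> pre j k (W j)"
      using limit_bond[OF j(3) k(2)] limit_mem[OF j(3)] index_mem[OF k(2)] j(2) by simp
    then have "z k \<in> W k" using compatible_pre[OF W k(2)] by blast
    then show ?thesis using k(1) z_above[OF k(1)] y yX by auto
  qed
  have "\<nu> i V = \<nu> i (\<Union>j\<in>?J. ?A j)"
    using A_cover by (intro arg_cong[of _ _ "\<nu> i"]) blast
  also have "\<dots> = (SUP j\<in>?J. \<nu> i (?A j))"
  proof (rule continuous_valuation_UN[OF thread_valuation[OF \<nu> i] _ A_open])
    show "?J \<noteq> {}" using index_refl[OF i] by blast
    fix j k assume jk: "j \<in> ?J" "k \<in> ?J"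
    then have "j \<in> I" "k \<in> I" using index_mem(2)[of i] by simp_all
    then obtain l where "(j, l) \<in> r" "(k, l) \<in> r" by (rule index_upper_bound)
    then show "\<exists>l\<in>?J. ?A j \<subseteq> ?A l \<and> ?A k \<subseteq> ?A l"
      using jk A_mono index_trans[of i j l] by (intro bexI[of _ l] conjI) auto
  qed simp
  finally obtain j where j: "(i, j) \<in> r" "c < \<nu> i (?A j)"
    using c by (auto simp: less_SUP_iff)
  have "\<nu> i (?A j) = \<nu> j (pre i j (?A j))"
    using thread_pre[OF \<nu> j(1) A_open] j(1) by simp
  also have "\<dots> \<le> \<nu> j (W j)"
  proof (rule continuous_valuation_mono)
    note jI = index_mem(2)[OF j(1)]
    show "continuous_valuation (X j) (\<nu> j)" by (rule thread_valuation[OF \<nu> jI])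
    show "openin (X j) (pre i j (?A j))" using j(1) by (intro openin_pre A_open) auto
    show W_open: "openin (X j) (W j)" by (rule compatible_openin[OF W jI])
    show "pre i j (?A j) \<subseteq> W j"
      using e(3)[OF j(1)] W_open by (auto simp: spec_le_def)
  qed
  finally show "\<exists>j\<in>I. c < \<nu> j (W j)"
    using j index_mem(2)[OF j(1)] by (intro bexI[of _ j]) auto
qed

end

section \<open>Consonant sober spaces and proper maps\<close>

lemma compactin_directed:
  assumes Q: "compactin Y Q" and D: "directed_opens Y D" and sub: "Q \<subseteq> \<Union>D"
  shows "\<exists>U\<in>D. Q \<subseteq> U"
proof -
  have op: "openin Y U" if "U \<in> D" for U using that D by (simp add: directed_opens_def)
  obtain E where E: "finite E" "E \<subseteq> D" "Q \<subseteq> \<Union>E"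
    using compactinD[OF Q op sub] by blast
  have "\<exists>U\<in>D. \<Union>E \<subseteq> U" using E(1,2)
  proof (induction E)
    case empty
    then show ?case using D by (auto simp: directed_opens_def)
  next
    case (insert A E)
    then obtain U where U: "U \<in> D" "\<Union>E \<subseteq> U" by auto
    then obtain Z where "Z \<in> D" "A \<subseteq> Z" "U \<subseteq> Z"
      using directed_opens_upper_bound[OF D, of A U] insert.prems by blast
    then show ?case using U by (intro bexI[of _ Z]) auto
  qed
  then obtain U where "U \<in> D" "\<Union>E \<subseteq> U" by (rule bexE)
  then show ?thesis using E(3) by (intro bexI[of _ U]) auto
qed

lemma scott_open_family_neighbourhoods:
  assumes "compactin Y Q"
  shows "scott_open_family Y {U. openin Y U \<and> Q \<subseteq> U}"
  unfolding scott_open_family_def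
proof (intro conjI allI impI)
  fix D assume D: "directed_opens Y D \<and> \<Union>D \<in> {U. openin Y U \<and> Q \<subseteq> U}"
  then obtain U where "U \<in> D" "Q \<subseteq> U" using compactin_directed[OF assms] by blast
  then show "\<exists>U\<in>D. U \<in> {U. openin Y U \<and> Q \<subseteq> U}"
    using D by (intro bexI[of _ U]) (simp_all add: directed_opens_def)
qed auto

text \<open>The closed set \<open>\<down>f(Y - N)\<close> misses the saturated set \<open>Q\<close>, so its complement is the required
  neighbourhood.\<close>

lemma order_proper_map_neighbourhood:
  assumes f: "order_proper_map Y Z f" and Q: "saturated_in Z Q"
    and N: "openin Y N" "{y \<in> topspace Y. f y \<in> Q} \<subseteq> N"
  obtains V where "openin Z V" "Q \<subseteq> V" "{y \<in> topspace Y. f y \<in> V} \<subseteq> N"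
proof
  let ?D = "down_closure Z (f ` (topspace Y - N))"
  have "closedin Z ?D"
    using f N(1) unfolding order_proper_map_def by blast
  then show "openin Z (topspace Z - ?D)" by blast
  have "q \<notin> ?D" if "q \<in> Q" for q
  proof
    assume "q \<in> ?D"
    then obtain y where "y \<in> topspace Y" "y \<notin> N" "spec_le Z q (f y)"
      by (auto simp: down_closure_def)
    then show False using Q that N(2) unfolding saturated_in_def by blast
  qed
  then show "Q \<subseteq> topspace Z - ?D" using Q by (auto simp: saturated_in_def)
  have "continuous_map Y Z f" using f by (simp add: order_proper_map_def)
  then have "f y \<in> ?D" if "y \<in> topspace Y" "y \<notin> N" for y
    using that continuous_map_image_subset_topspace unfolding down_closure_def spec_le_def by blast
  then show "{y \<in> topspace Y. f y \<in> topspace Z - ?D} \<subseteq> N" by blast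
qed

context projective_sys
begin

text \<open>Consonance shrinks \<open>V\<close> to a compact saturated set \<open>Q\<close> all of whose open neighbourhoods have
  mass greater than \<open>c\<close>.  By properness the preimages of \<open>Q\<close> along the system are compact and have
  the same property, so a family \<open>W\<close> of lighter open sets contains none of them; the filters of
  open neighbourhoods of these preimages then yield a point of the limit that \<open>W\<close> misses.\<close>

lemma tight_consonant:
  assumes cons: "\<And>i. i \<in> I \<Longrightarrow> consonant_space (X i)"
    and sober: "\<And>i. i \<in> I \<Longrightarrow> sober_space (X i)"
    and proper: "\<And>i j. (i, j) \<in> r \<Longrightarrow> order_proper_map (X j) (X i) (p i j)"
    and \<nu>: "thread \<nu>"
  shows "tight \<nu>"
proof (rule tightI, rule ccontr)
  fix i V W c
  assume i: "i \<in> I" and V: "openin (X i) V" and W: "compatible W"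
    and cover: "lpre i V \<subseteq> (\<Union>j\<in>I. lpre j (W j))" and c: "c < \<nu> i V"
    and light: "\<not> (\<exists>j\<in>I. c < \<nu> j (W j))"
  obtain Q where Q: "compactin (X i) Q" "saturated_in (X i) Q" "Q \<subseteq> V"
    "\<And>U. openin (X i) U \<Longrightarrow> Q \<subseteq> U \<Longrightarrow> c < \<nu> i U"
    using cons[OF i, unfolded consonant_space_def, rule_format,
        OF conjI[OF scott_open_family_above_mass[OF thread_valuation[OF \<nu> i]]], of V c] V c
    by auto
  define F where "F k = {U. openin (X k) U \<and> pre i k Q \<subseteq> U}" for k
  have W_F: "W k \<notin> F k" if ik: "(i, k) \<in> r" for k
  proof
    assume "W k \<in> F k"
    then obtain U where U: "openin (X i) U" "Q \<subseteq> U" "pre i k U \<subseteq> W k"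
      using order_proper_map_neighbourhood[OF proper[OF ik] Q(2)] unfolding F_def by blast
    have "c < \<nu> i U" by (rule Q(4)[OF U(1,2)])
    also have "\<nu> i U = \<nu> k (pre i k U)" using thread_pre[OF \<nu> ik U(1)] by simp
    also have "\<dots> \<le> \<nu> k (W k)"
      by (intro continuous_valuation_mono[OF thread_valuation[OF \<nu>]] openin_pre[OF ik U(1)]
          compatible_openin[OF W] U(3) index_mem(2)[OF ik])
    finally show False using light index_mem(2)[OF ik] by blast
  qed
  show False
  proof (rule limit_point_of_scott_filters[of "{k. (i, k) \<in> r}" "\<lambda>k. k" F W])
    show "sober_space (X j)" if "j \<in> I" for j by (rule sober[OF that])
    show "k \<in> I" if "k \<in> {k. (i, k) \<in> r}" for k
      using that index_mem(2)[of i k] by simp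
    show "\<exists>k\<in>{k. (i, k) \<in> r}. (j, k) \<in> r" if "j \<in> I" for j
      using index_upper_bound[OF i that] by blast
    show "scott_open_family (X k) (F k)" if "k \<in> {k. (i, k) \<in> r}" for k
    proof -
      have "compactin (X k) (pre i k Q)"
        using proper[of i k] that Q(1,2) unfolding order_proper_map_def by simp
      then show ?thesis unfolding F_def by (rule scott_open_family_neighbourhoods)
    qed
    show "topspace (X k) \<in> F k" for k by (auto simp: F_def)
    show "A \<inter> B \<in> F k" if "A \<in> F k" "B \<in> F k" for k A B using that by (auto simp: F_def)
    show "compatible W" by (rule W)
    show "W k \<notin> F k" if "k \<in> {k. (i, k) \<in> r}" for k using W_F that by blast
    have trans: "pre k l ` F k \<subseteq> F l" if ik: "(i, k) \<in> r" and kl: "(k, l) \<in> r" for k l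
    proof
      fix B assume "B \<in> pre k l ` F k"
      then obtain A where A: "B = pre k l A" "openin (X k) A" "pre i k Q \<subseteq> A"
        by (auto simp: F_def)
      have "pre i l Q = pre k l (pre i k Q)" using pre_pre[OF ik kl] by simp
      also have "\<dots> \<subseteq> B" using A(1,3) by auto
      finally show "B \<in> F l" using openin_pre[OF kl A(2)] A(1) by (simp add: F_def)
    qed
    show "\<exists>l\<in>{k. (i, k) \<in> r}. (k, l) \<in> r \<and> (k', l) \<in> r \<and> pre k l ` F k \<subseteq> F l \<and> pre k' l ` F k' \<subseteq> F l"
      if k: "k \<in> {k. (i, k) \<in> r}" "k' \<in> {k. (i, k) \<in> r}" for k k'
    proof -
      have "k \<in> I" "k' \<in> I" using k index_mem(2)[of i] by simp_all
      then obtain l where "(k, l) \<in> r" "(k', l) \<in> r" by (rule index_upper_bound)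
      then show ?thesis
        using k trans index_trans[of i k l] by (intro bexI[of _ l] conjI) auto
    qed
    fix x assume x: "x \<in> topspace L" "\<And>j. j \<in> I \<Longrightarrow> x j \<notin> W j"
      "\<And>k A. k \<in> {k. (i, k) \<in> r} \<Longrightarrow> A \<in> F k \<Longrightarrow> x k \<in> A"
    have "pre i i Q \<subseteq> V" using Q(3) bond_id[OF i] by auto
    then have "V \<in> F i" using V by (simp add: F_def)
    then have "x i \<in> V" using x(3)[of i V] index_refl[OF i] by simp
    then show False using cover x(1,2) by blast
  qed
qed

end

section \<open>LCS-complete spaces\<close>

text \<open>The Hofmann-Mislove theorem, as the case of a one-element index set.\<close>

lemma sober_scott_filter_point:
  assumes sober: "sober_space Y" and F: "scott_open_family Y F" "topspace Y \<in> F"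
      "\<And>U V. U \<in> F \<Longrightarrow> V \<in> F \<Longrightarrow> U \<inter> V \<in> F"
    and W: "openin Y W" "W \<notin> F"
  obtains y where "y \<in> topspace Y" "y \<notin> W" "\<And>A. A \<in> F \<Longrightarrow> y \<in> A"
proof -
  interpret U: projective_sys "{()}" "{((), ())}" "\<lambda>_. Y" "\<lambda>_ _ y. y"
  proof
    show "projective_system {()} {((), ())} (\<lambda>_. Y) (\<lambda>_ _ y. y)"
      unfolding projective_system_def directed_preorder_on_def preorder_on_def refl_on_def trans_def
      by simp
  qed
  have F_open: "openin Y U" if "U \<in> F" for U
    using F(1) that unfolding scott_open_family_def by blast
  have F_pre: "{y \<in> topspace Y. y \<in> U} = U" if "U \<in> F" for U
    using openin_subset[OF F_open[OF that]] by blast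
  show ?thesis
  proof (rule U.limit_point_of_scott_filters[of "{()}" "\<lambda>u. u" "\<lambda>_. F" "\<lambda>_. W"])
    show "U.compatible (\<lambda>_. W)"
      using W(1) by (auto simp: U.compatible_def)
    fix x assume x: "x \<in> topspace U.L" "\<And>i. i \<in> {()} \<Longrightarrow> x i \<notin> W"
      "\<And>k A. k \<in> {()} \<Longrightarrow> A \<in> F \<Longrightarrow> x k \<in> A"
    show thesis
      using that[of "x ()"] U.limit_mem[OF x(1), of "()"] x(2,3)[of "()"] by blast
  qed (use sober F W F_pre in auto)
qed

text \<open>The presentation of an LCS-complete space that the construction below works with: the open sets
  whose intersection is the \<open>G\<^sub>\<delta>\<close> set are listed in decreasing order, and the homeomorphism is
  read as an embedding into the ambient space.\<close>

definition gdelta_chart :: "'a topology \<Rightarrow> 'c topology \<Rightarrow> ('a \<Rightarrow> 'c) \<Rightarrow> (nat \<Rightarrow> 'c set) \<Rightarrow> bool" where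
  "gdelta_chart X Y h G \<longleftrightarrow> loc_compact_space Y \<and> sober_space Y \<and> (\<forall>m. openin Y (G m)) \<and>
     (\<forall>m. G (Suc m) \<subseteq> G m) \<and> embedding_map X Y h \<and> h ` topspace X = (\<Inter>m. G m)"

lemma lcs_complete_gdelta_chart:
  assumes "lcs_complete TYPE('c) X"
  obtains Y :: "'c topology" and h G where "gdelta_chart X Y h G"
proof -
  obtain Y :: "'c topology" and S h where Y: "loc_compact_space Y" "sober_space Y" "gdelta_in Y S"
    and h: "homeomorphic_map X (subtopology Y S) h"
    using assms unfolding lcs_complete_def homeomorphic_space by blast
  obtain G where G: "\<And>m. openin Y (G m)" "\<And>m. G (Suc m) \<subseteq> G m" "(\<Inter>m. G m) = S"
    using Y(3) unfolding gdelta_in_descending by auto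
  have "S \<subseteq> topspace Y" using Y(3) gdelta_in_subset by blast
  then have img: "h ` topspace X = S"
    using homeomorphic_imp_surjective_map[OF h] by auto
  then have "gdelta_chart X Y h G"
    using Y G h by (simp add: gdelta_chart_def embedding_map_def)
  then show ?thesis by (rule that)
qed

lemma lcs_complete_locally_compact:
  fixes X :: "'a topology"
  assumes "loc_compact_space X" "sober_space X"
  shows "lcs_complete TYPE('a) X"
  unfolding lcs_complete_def using assms
  by (intro exI[of _ X] exI[of _ "topspace X"])
    (simp add: open_imp_gdelta_in homeomorphic_space_refl)

lemma gdelta_chart_continuous: "gdelta_chart X Y h G \<Longrightarrow> continuous_map X Y h"
  unfolding gdelta_chart_def embedding_map_def
  by (elim conjE) (rule continuous_map_into_fulltopology, erule homeomorphic_imp_continuous_map)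

lemma gdelta_chart_open:
  assumes "gdelta_chart X Y h G" "openin X U"
  obtains B where "openin Y B" "{x \<in> topspace X. h x \<in> B} = U"
proof -
  have h: "homeomorphic_map X (subtopology Y (h ` topspace X)) h"
    using assms(1) unfolding gdelta_chart_def embedding_map_def by (elim conjE)
  have U: "U \<subseteq> topspace X" using assms(2) openin_subset by blast
  have "openin (subtopology Y (h ` topspace X)) (h ` U)"
    using homeomorphic_map_openness[OF h U] assms(2) by simp
  then obtain B where B: "openin Y B" "h ` U = B \<inter> h ` topspace X"
    by (auto simp: openin_subtopology)
  have "x \<in> U" if "x \<in> topspace X" "h x \<in> B" for x
  proof -
    have "h x \<in> h ` U" using that B(2) by blast
    then show ?thesis
      using homeomorphic_imp_injective_map[OF h] that(1) U by (meson inj_on_image_mem_iff)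
  qed
  then have "{x \<in> topspace X. h x \<in> B} = U" using B(2) U by blast
  then show ?thesis using that B(1) by blast
qed

text \<open>Sobriety passes to a \<open>G\<^sub>\<delta>\<close> subspace: a point of the ambient space whose closure is that of
  a nonempty part of the subspace belongs to each of the open sets \<open>G m\<close>.\<close>

lemma sober_gdelta_chart:
  assumes chart: "gdelta_chart X Y h G"
  shows "sober_space X"
  unfolding sober_space_def
proof (intro conjI allI impI)
  note cont = gdelta_chart_continuous[OF chart]
  have Y: "sober_space Y" and G: "\<And>m. openin Y (G m)" and img: "h ` topspace X = (\<Inter>m. G m)"
    and h: "homeomorphic_map X (subtopology Y (h ` topspace X)) h"
    using chart unfolding gdelta_chart_def embedding_map_def by blast+
  have "t0_space (subtopology Y (h ` topspace X))"
    using Y by (simp add: sober_space_def t0_space_subtopology)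
  then show "t0_space X"
    using homeomorphic_t0_space h homeomorphic_map_imp_homeomorphic_space by blast
  fix C assume C: "irreducible_closedin X C"
  then have closed: "closedin X C" and ne: "C \<noteq> {}"
    and irr: "\<And>A B. closedin X A \<Longrightarrow> closedin X B \<Longrightarrow> C \<subseteq> A \<union> B \<Longrightarrow> C \<subseteq> A \<or> C \<subseteq> B"
    by (simp_all add: irreducible_closedin_def)
  have CX: "C \<subseteq> topspace X" using closed closedin_subset by blast
  have CY: "h ` C \<subseteq> topspace Y" using CX continuous_map_image_subset_topspace[OF cont] by blast
  let ?D = "Y closure_of (h ` C)"
  have CD: "h ` C \<subseteq> ?D" using CY by (rule closure_of_subset)
  have "irreducible_closedin Y ?D"
    unfolding irreducible_closedin_def
  proof (intro conjI allI impI)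
    show "closedin Y ?D" by simp
    show "?D \<noteq> {}" using CD ne by blast
    fix A B assume AB: "closedin Y A \<and> closedin Y B \<and> ?D \<subseteq> A \<union> B"
    have "C \<subseteq> {x \<in> topspace X. h x \<in> A} \<or> C \<subseteq> {x \<in> topspace X. h x \<in> B}"
      using AB CD CX by (intro irr closedin_continuous_map_preimage[OF cont]) auto
    then have "h ` C \<subseteq> A \<or> h ` C \<subseteq> B" by blast
    then show "?D \<subseteq> A \<or> ?D \<subseteq> B" using AB closure_of_minimal by metis
  qed
  then obtain y where y: "y \<in> topspace Y" "?D = Y closure_of {y}"
    using Y by (auto simp: sober_space_def)
  have above: "y \<in> B" if "openin Y B" "c \<in> C" "h c \<in> B" for B c
  proof -
    have "h c \<in> Y closure_of {y}" using CD y(2) that(2) by blast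
    then show ?thesis using that(1,3) by (auto simp: in_closure_of)
  qed
  obtain c where c: "c \<in> C" using ne by blast
  have "h c \<in> G m" for m using c CX img by blast
  then have "y \<in> h ` topspace X"
    unfolding img using above[OF G c] by blast
  then obtain x where x: "x \<in> topspace X" "y = h x" by blast
  have "C = X closure_of {x}"
  proof
    show "C \<subseteq> X closure_of {x}"
    proof
      fix c assume c: "c \<in> C"
      have "x \<in> U" if U: "openin X U" "c \<in> U" for U
      proof -
        obtain B where B: "openin Y B" "{x \<in> topspace X. h x \<in> B} = U"
          using gdelta_chart_open[OF chart U(1)] by blast
        then have "y \<in> B" using above[OF B(1) c] U(2) by blast
        then show ?thesis using B(2) x by blast
      qed
      then show "c \<in> X closure_of {x}" using c CX by (auto simp: in_closure_of)
    qed
    have "x \<in> C"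
    proof (rule ccontr)
      assume "x \<notin> C"
      obtain B where B: "openin Y B" "{x \<in> topspace X. h x \<in> B} = topspace X - C"
        using gdelta_chart_open[OF chart openin_diff[OF openin_topspace closed]] by blast
      have "y \<in> ?D" using closure_of_subset[of "{y}" Y] y by simp
      moreover have "y \<in> B" using B(2) x \<open>x \<notin> C\<close> by blast
      ultimately obtain c where "c \<in> C" "h c \<in> B" using B(1) by (auto simp: in_closure_of)
      then show False using B(2) CX by blast
    qed
    then show "X closure_of {x} \<subseteq> C" using closed by (simp add: closure_of_minimal)
  qed
  then show "\<exists>x\<in>topspace X. C = X closure_of {x}" using x(1) by blast
qed

text \<open>A decreasing sequence of open sets of the ambient space that is interpolated infinitely often
  by compact sets, which moreover enter each \<open>G m\<close>, has an intersection that is a compact subset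
  of the \<open>G\<^sub>\<delta>\<close> set, with the members of the sequence as a base of neighbourhoods.  Read in \<open>X\<close>, this
  says that the traces of the sequence generate a Scott-open filter.\<close>

lemma scott_open_family_gdelta_chart:
  assumes chart: "gdelta_chart X Y h G"
    and b: "\<And>t. openin Y (b t)" "\<And>t. b (Suc t) \<subseteq> b t"
    and interpolate: "\<And>t. \<exists>t'\<ge>t. \<exists>Q. compactin Y Q \<and> b (Suc t') \<subseteq> Q \<and> Q \<subseteq> b t' \<inter> G t'"
  shows "scott_open_family X {U. openin X U \<and> (\<exists>t. {x \<in> topspace X. h x \<in> b t} \<subseteq> U)}"
    (is "scott_open_family X ?F")
proof -
  let ?tr = "\<lambda>B. {x \<in> topspace X. h x \<in> B}"
  have Y: "sober_space Y" and G: "\<And>m. openin Y (G m)" "\<And>m. G (Suc m) \<subseteq> G m"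
    and img: "h ` topspace X = (\<Inter>m. G m)"
    using chart by (simp_all add: gdelta_chart_def)
  have b_mono: "b t' \<subseteq> b t" if "t \<le> t'" for t t'
    using lift_Suc_antimono_le[of b, OF b(2) that] .
  have G_mono: "G m' \<subseteq> G m" if "m \<le> m'" for m m'
    using lift_Suc_antimono_le[of G, OF G(2) that] .
  define E where "E = {B. openin Y B \<and> (\<exists>t. b t \<subseteq> B)}"
  have E_scott: "scott_open_family Y E"
    unfolding scott_open_family_def
  proof (intro conjI allI impI ballI)
    fix D assume D: "directed_opens Y D \<and> \<Union>D \<in> E"
    then obtain t where t: "b t \<subseteq> \<Union>D" by (auto simp: E_def)
    obtain t' Q where Q: "t \<le> t'" "compactin Y Q" "b (Suc t') \<subseteq> Q" "Q \<subseteq> b t'"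
      using interpolate[of t] by blast
    then have "Q \<subseteq> \<Union>D" using b_mono[OF Q(1)] t by (meson order_trans)
    then obtain U where U: "U \<in> D" "Q \<subseteq> U"
      using compactin_directed[OF Q(2)] D by blast
    then have "openin Y U" "b (Suc t') \<subseteq> U" using D Q(3) by (auto simp: directed_opens_def)
    then show "\<exists>U\<in>D. U \<in> E" using U(1) by (auto simp: E_def)
  next
    fix U V assume UV: "U \<in> E \<and> openin Y V \<and> U \<subseteq> V"
    then obtain t where "b t \<subseteq> U" by (auto simp: E_def)
    then have "b t \<subseteq> V" using UV by (meson order_trans)
    then show "V \<in> E" using UV by (auto simp: E_def)
  qed (simp add: E_def)
  have E_Int: "U \<inter> V \<in> E" if UV: "U \<in> E" "V \<in> E" for U V
  proof -
    obtain t t' where "b t \<subseteq> U" "b t' \<subseteq> V" using UV by (auto simp: E_def)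
    then have "b (max t t') \<subseteq> U \<inter> V"
      using b_mono[of t "max t t'"] b_mono[of t' "max t t'"] by auto
    then show ?thesis using UV by (auto simp: E_def)
  qed
  have b_E: "b t \<in> E" for t using b(1) by (auto simp: E_def)
  have G_E: "G m \<in> E" for m
  proof -
    obtain t' Q where "m \<le> t'" "b (Suc t') \<subseteq> Q" "Q \<subseteq> G t'"
      using interpolate[of m] by blast
    then have "b (Suc t') \<subseteq> G m" using G_mono[of m t'] by (meson order_trans)
    then show ?thesis using G(1) by (auto simp: E_def)
  qed
  have top_E: "topspace Y \<in> E" using b(1)[THEN openin_subset] by (auto simp: E_def)
  show ?thesis
    unfolding scott_open_family_def
  proof (intro conjI allI impI ballI)
    fix D assume D: "directed_opens X D \<and> \<Union>D \<in> ?F"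
    then obtain t where t: "?tr (b t) \<subseteq> \<Union>D" by auto
    have D_open: "openin X d" if "d \<in> D" for d using that D by (simp add: directed_opens_def)
    \<comment> \<open>Taking largest extensions makes a directed family in \<open>X\<close> directed in the ambient space.\<close>
    define ext where "ext d = \<Union>{B. openin Y B \<and> ?tr B \<subseteq> d}" for d
    have ext_open: "openin Y (ext d)" for d by (auto simp: ext_def)
    have tr_ext: "?tr (ext d) = d" if d: "openin X d" for d
    proof -
      obtain B where "openin Y B" "?tr B = d" using gdelta_chart_open[OF chart d] by blast
      then show ?thesis unfolding ext_def by blast
    qed
    have dir: "directed_opens Y (ext ` D)"
      unfolding directed_opens_def
    proof (intro conjI ballI)
      show "ext ` D \<noteq> {}" using D by (simp add: directed_opens_def)
      show "openin Y B" if "B \<in> ext ` D" for B using that ext_open by blast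
      fix A B assume "A \<in> ext ` D" "B \<in> ext ` D"
      then obtain d d' where d: "d \<in> D" "A = ext d" "d' \<in> D" "B = ext d'" by blast
      obtain e where e: "e \<in> D" "d \<subseteq> e" "d' \<subseteq> e"
        using directed_opens_upper_bound[of X D d d'] D d(1,3) by auto
      have "ext d \<subseteq> ext e" if "d \<subseteq> e" for d using that unfolding ext_def by blast
      then show "\<exists>Z\<in>ext ` D. A \<subseteq> Z \<and> B \<subseteq> Z"
        using d e by (intro bexI[of _ "ext e"]) auto
    qed
    have "\<Union>(ext ` D) \<in> E"
    proof (rule ccontr)
      assume out: "\<Union>(ext ` D) \<notin> E"
      have ext_Un: "openin Y (\<Union>(ext ` D))" using ext_open by blast
      obtain y where y: "y \<notin> \<Union>(ext ` D)" "\<And>A. A \<in> E \<Longrightarrow> y \<in> A"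
        by (rule sober_scott_filter_point[OF Y E_scott top_E _ ext_Un out]) (use E_Int that in auto)
      have "y \<in> h ` topspace X" unfolding img using y(2)[OF G_E] by blast
      then obtain x where x: "x \<in> topspace X" "y = h x" by blast
      then have "x \<in> ?tr (b t)" using y(2)[OF b_E] by blast
      then obtain d where d: "d \<in> D" "x \<in> d" using t by blast
      then have "x \<in> ?tr (ext d)" using tr_ext[OF D_open] by blast
      then show False using y(1) d(1) x(2) by blast
    qed
    then obtain d where d: "d \<in> D" "ext d \<in> E"
      using E_scott dir unfolding scott_open_family_def by blast
    then obtain t' where "b t' \<subseteq> ext d" by (auto simp: E_def)
    then have "?tr (b t') \<subseteq> ?tr (ext d)" by blast
    then have "?tr (b t') \<subseteq> d" using tr_ext[OF D_open[OF d(1)]] by simp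
    then show "\<exists>d\<in>D. d \<in> ?F" using d(1) D_open by blast
  next
    fix U V assume UV: "U \<in> ?F \<and> openin X V \<and> U \<subseteq> V"
    then obtain t where "?tr (b t) \<subseteq> U" by auto
    then have "?tr (b t) \<subseteq> V" using UV by (meson order_trans)
    then show "V \<in> ?F" using UV by blast
  qed simp
qed

lemma prod_encode_bounds: "t \<le> prod_encode (n, t)" "fst (prod_decode t) \<le> t"
  using le_prod_encode_2[of t n] le_prod_encode_1[of "fst (prod_decode t)" "snd (prod_decode t)"]
  by simp_all

lemma loc_compact_interior:
  assumes "loc_compact_space Y" "openin Y B" "y \<in> B"
  obtains U Q where "openin Y U" "compactin Y Q" "y \<in> U" "U \<subseteq> Q" "Q \<subseteq> B"
  using assms(1)[unfolded loc_compact_space_def neighbourhood_base_of, rule_format,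
      OF conjI[OF assms(2,3)]] that by (elim exE conjE)

context projective_sys
begin

text \<open>Each stage \<open>t\<close> of the construction keeps an open set \<open>B t n\<close> of the ambient space of the \<open>n\<close>th
  space for each \<open>n\<close>, and shrinks one of them, at a level \<open>n \<le> t\<close> chosen so that every level is
  visited infinitely often.  The new set is interpolated by a compact set, lies in \<open>G n t\<close>, and its
  trace maps into the traces of the current sets below.  The invariant is that the set of points
  of the space of index \<open>s t\<close> that project into all the sets \<open>B t k\<close>, \<open>k \<le> t\<close>, has mass
  greater than \<open>c\<close>. Shrinking preserves it because the candidates for the new set form a
  directed family with a large enough union, and the valuation of index \<open>s t\<close> is Scott-continuous.
  At each level the traces generate a Scott-open filter; if every \<open>W j\<close> had mass at most
  \<open>c\<close>, then no \<open>W (s n)\<close> would belong to the filter of level \<open>n\<close>, and \<open>W\<close> would miss a point of the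
  preimage of \<open>V\<close>.\<close>

lemma tight_gdelta_sequence:
  fixes s :: "nat \<Rightarrow> 'i" and Y :: "nat \<Rightarrow> 'c topology"
  assumes sober: "\<And>i. i \<in> I \<Longrightarrow> sober_space (X i)"
    and s: "\<And>n. (s n, s (Suc n)) \<in> r" "\<And>i. i \<in> I \<Longrightarrow> \<exists>n. (i, s n) \<in> r"
    and chart: "\<And>n. gdelta_chart (X (s n)) (Y n) (h n) (G n)"
    and \<nu>: "thread \<nu>" and V: "openin (X (s 0)) V" "c < \<nu> (s 0) V"
    and W: "compatible W" and cover: "lpre (s 0) V \<subseteq> (\<Union>j\<in>I. lpre j (W j))"
  shows "\<exists>j\<in>I. c < \<nu> j (W j)"
proof (rule ccontr)
  assume light: "\<not> (\<exists>j\<in>I. c < \<nu> j (W j))"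
  have sI: "s n \<in> I" for n using index_mem(1)[OF s(1)] .
  have s_mono: "(s m, s n) \<in> r" if "m \<le> n" for m n
    using that
  proof (induction rule: dec_induct)
    case base
    show ?case by (rule index_refl[OF sI])
  next
    case (step n)
    show ?case by (rule index_trans[OF step.IH s(1)])
  qed
  have s_zero: "(s 0, s n) \<in> r" for n by (rule s_mono) simp
  have val: "continuous_valuation (X (s n)) (\<nu> (s n))" for n by (rule thread_valuation[OF \<nu> sI])
  have cont: "continuous_map (X (s n)) (Y n) (h n)" for n
    by (rule gdelta_chart_continuous[OF chart])
  have Y_lc: "loc_compact_space (Y n)" and G_open: "openin (Y n) (G n m)"
    and G_img: "h n ` topspace (X (s n)) = (\<Inter>m. G n m)" for n m
    using chart[of n] unfolding gdelta_chart_def by blast+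
  define tr where "tr n A = {x \<in> topspace (X (s n)). h n x \<in> A}" for n A
  have tr_open: "openin (X (s n)) (tr n A)" if "openin (Y n) A" for n A
    unfolding tr_def by (rule openin_continuous_map_preimage[OF cont that])
  define M where
    "M b n = {x \<in> topspace (X (s n)). \<forall>k\<le>n. p (s k) (s n) x \<in> tr k (b k)}" for b n
  have M_open: "openin (X (s n)) (M b n)" if "\<And>k. openin (Y k) (b k)" for b n
  proof -
    have "M b n = topspace (X (s n)) \<inter> (\<Inter>k\<in>{..n}. pre (s k) (s n) (tr k (b k)))"
      by (auto simp: M_def)
    also have "openin (X (s n)) \<dots>"
      using openin_pre[OF s_mono tr_open[OF that]] by (intro openin_Int_Inter) auto
    finally show ?thesis .
  qed
  have M_project: "M b n \<subseteq> pre (s k) (s n) (M b k)" if "k \<le> n" for b k n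
  proof
    fix x assume x: "x \<in> M b n"
    then have "p (s j) (s k) (p (s k) (s n) x) \<in> tr j (b j)" if "j \<le> k" for j
      using bond_compose[OF s_mono[OF \<open>j \<le> k\<close>] s_mono[OF \<open>k \<le> n\<close>]] that \<open>k \<le> n\<close>
      by (auto simp: M_def)
    then show "x \<in> pre (s k) (s n) (M b k)"
      using x bond_mem[OF s_mono[OF that]] by (auto simp: M_def)
  qed
  define visit where "visit t = fst (prod_decode t)" for t
  have visit_le: "visit t \<le> t" for t unfolding visit_def by (rule prod_encode_bounds)
  have visit_again: "\<exists>t'\<ge>t. visit t' = n" for t n
    using prod_encode_bounds(1)[of t n] unfolding visit_def by (intro exI[of _ "prod_encode (n, t)"]) simp
  \<comment> \<open>The levels above \<open>t\<close> have not been visited before stage \<open>t\<close>, so their sets are still full.\<close>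
  define inv where "inv t b \<longleftrightarrow> (\<forall>n. openin (Y n) (b n)) \<and> (\<forall>n>t. b n = topspace (Y n)) \<and>
    c < \<nu> (s t) (M b t) \<and> (t = 0 \<longrightarrow> tr 0 (b 0) \<subseteq> V)" for t b
  define move where "move t b b' \<longleftrightarrow> (\<forall>n. b' n \<subseteq> b n) \<and> (\<exists>Q. compactin (Y (visit t)) Q \<and>
    b' (visit t) \<subseteq> Q \<and> Q \<subseteq> b (visit t) \<inter> G (visit t) t) \<and>
    tr (visit t) (b' (visit t)) \<subseteq> M b (visit t)" for t b b'
  have init: "\<exists>b. inv 0 b"
  proof -
    obtain B where B: "openin (Y 0) B" "tr 0 B = V"
      using gdelta_chart_open[OF chart V(1)] unfolding tr_def by blast
    define b where "b n = (if n = 0 then B else topspace (Y n))" for n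
    have "M b 0 = V"
      using B(2) openin_subset[OF V(1)] bond_id[OF sI] by (auto simp: M_def b_def)
    then have "inv 0 b" using B V(2) by (simp add: inv_def b_def)
    then show ?thesis by blast
  qed
  have step: "\<exists>b'. inv (Suc t) b' \<and> move t b b'" if inv: "inv t b" for t b
  proof -
    define n where "n = visit t"
    have nt: "n \<le> t" unfolding n_def by (rule visit_le)
    have b: "\<And>n. openin (Y n) (b n)" "\<And>n. t < n \<Longrightarrow> b n = topspace (Y n)" "c < \<nu> (s t) (M b t)"
      using inv by (simp_all add: inv_def)
    obtain C where C: "openin (Y n) C" "tr n C = M b n"
      using gdelta_chart_open[OF chart M_open[of b, OF b(1)]] unfolding tr_def by blast
    define B where "B = b n \<inter> C \<inter> G n t"
    have B_open: "openin (Y n) B" unfolding B_def by (intro openin_Int b(1) C(1) G_open)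
    \<comment> \<open>The candidates for the new set at level \<open>n\<close>, and the parts of \<open>M b t\<close> that they retain.\<close>
    define \<A> where "\<A> = {A. openin (Y n) A \<and> (\<exists>Q. compactin (Y n) Q \<and> A \<subseteq> Q \<and> Q \<subseteq> B)}"
    define S where "S A = M b t \<inter> pre (s n) (s t) (tr n A)" for A
    have S_open: "openin (X (s t)) (S A)" if "A \<in> \<A>" for A
      unfolding S_def using that
      by (intro openin_Int M_open[of b, OF b(1)] openin_pre[OF s_mono[OF nt] tr_open])
        (simp add: \<A>_def)
    have "\<exists>A\<in>\<A>. x \<in> S A" if x: "x \<in> M b t" for x
    proof -
      let ?z = "p (s n) (s t) x"
      have z: "?z \<in> M b n" using M_project[OF nt] x by blast
      then have zX: "?z \<in> topspace (X (s n))" by (simp add: M_def)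
      have "h n ?z \<in> C" using z C(2) by (auto simp: tr_def)
      moreover have "h n ?z \<in> b n" using x nt by (auto simp: M_def tr_def)
      moreover have "h n ?z \<in> G n t" using zX G_img[of n] by blast
      ultimately have "h n ?z \<in> B" by (simp add: B_def)
      then obtain A Q where A: "openin (Y n) A" "compactin (Y n) Q" "h n ?z \<in> A" "A \<subseteq> Q" "Q \<subseteq> B"
        using loc_compact_interior[OF Y_lc B_open] by blast
      then have "A \<in> \<A>" unfolding \<A>_def by blast
      moreover have "x \<in> S A" using x A(3) zX by (auto simp: S_def tr_def M_def)
      ultimately show ?thesis by blast
    qed
    then have "M b t = (\<Union>A\<in>\<A>. S A)" by (auto simp: S_def)
    moreover have "\<nu> (s t) (\<Union>A\<in>\<A>. S A) = (SUP A\<in>\<A>. \<nu> (s t) (S A))"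
    proof (rule continuous_valuation_UN[OF val _ S_open])
      have "{} \<in> \<A>" unfolding \<A>_def using compactin_empty[of "Y n"] openin_empty[of "Y n"] by auto
      then show "\<A> \<noteq> {}" by blast
      fix A A' assume A: "A \<in> \<A>" "A' \<in> \<A>"
      then obtain Q Q' where "compactin (Y n) Q" "A \<subseteq> Q" "Q \<subseteq> B"
        "compactin (Y n) Q'" "A' \<subseteq> Q'" "Q' \<subseteq> B" unfolding \<A>_def by blast
      then have "compactin (Y n) (Q \<union> Q')" "A \<union> A' \<subseteq> Q \<union> Q'" "Q \<union> Q' \<subseteq> B"
        using compactin_Un by blast+
      then have "A \<union> A' \<in> \<A>" using A unfolding \<A>_def by blast
      then show "\<exists>Z\<in>\<A>. S A \<subseteq> S Z \<and> S A' \<subseteq> S Z"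
        by (intro bexI[of _ "A \<union> A'"]) (auto simp: S_def tr_def)
    qed
    ultimately obtain A where A: "A \<in> \<A>" "c < \<nu> (s t) (S A)"
      using b(3) by (auto simp: less_SUP_iff)
    then obtain Q where Q: "compactin (Y n) Q" "A \<subseteq> Q" "Q \<subseteq> B" "openin (Y n) A"
      unfolding \<A>_def by blast
    define b' where "b' = b(n := A)"
    have b'_open: "openin (Y k) (b' k)" for k using b(1) Q(4) by (simp add: b'_def)
    have tt: "(s t, s (Suc t)) \<in> r" by (rule s(1))
    have "pre (s t) (s (Suc t)) (S A) \<subseteq> M b' (Suc t)"
    proof
      fix x assume "x \<in> pre (s t) (s (Suc t)) (S A)"
      then have x: "x \<in> topspace (X (s (Suc t)))" "p (s t) (s (Suc t)) x \<in> S A" by auto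
      have "p (s k) (s (Suc t)) x \<in> tr k (b' k)" if k: "k \<le> Suc t" for k
      proof (cases "k = Suc t")
        case True
        then have "b' k = topspace (Y k)" using nt b(2) by (simp add: b'_def)
        then show ?thesis
          using True x(1) bond_id[OF sI x(1)] continuous_map_image_subset_topspace[OF cont]
          by (auto simp: tr_def)
      next
        case False
        then have kt: "k \<le> t" using k by simp
        have "p (s k) (s (Suc t)) x = p (s k) (s t) (p (s t) (s (Suc t)) x)"
          using bond_compose[OF s_mono[OF kt] tt x(1)] by simp
        moreover have "p (s k) (s t) (p (s t) (s (Suc t)) x) \<in> tr k (b' k)"
          using x(2) kt by (auto simp: S_def M_def b'_def)
        ultimately show ?thesis by simp
      qed
      then show "x \<in> M b' (Suc t)" using x(1) by (simp add: M_def)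
    qed
    then have "\<nu> (s (Suc t)) (pre (s t) (s (Suc t)) (S A)) \<le> \<nu> (s (Suc t)) (M b' (Suc t))"
      by (rule continuous_valuation_mono[OF val openin_pre[OF tt S_open[OF A(1)]]
            M_open[of b', OF b'_open]])
    then have "c < \<nu> (s (Suc t)) (M b' (Suc t))"
      using A(2) thread_pre[OF \<nu> tt S_open[OF A(1)]] by simp
    then have "inv (Suc t) b'"
      using b'_open nt b(2) by (simp add: inv_def b'_def)
    moreover have "move t b b'"
    proof -
      have "A \<subseteq> b n" "tr n A \<subseteq> M b n"
        using Q(2,3) C(2) by (auto simp: B_def tr_def)
      moreover have "Q \<subseteq> b n \<inter> G n t" using Q(3) by (auto simp: B_def)
      ultimately show ?thesis
        unfolding move_def n_def[symmetric] using Q(1,2) by (auto simp: b'_def)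
    qed
    ultimately show ?thesis by blast
  qed
  obtain B where B: "\<And>t. inv t (B t)" "\<And>t. move t (B t) (B (Suc t))"
    using dependent_nat_choice[of inv move, OF init step] by blast
  have B_open: "openin (Y n) (B t n)" and B_mass: "c < \<nu> (s t) (M (B t) t)" for t n
    using B(1)[of t] by (simp_all add: inv_def)
  have B_Suc: "B (Suc t) n \<subseteq> B t n" for t n using B(2)[of t] by (simp add: move_def)
  have B_mono: "B t' n \<subseteq> B t n" if "t \<le> t'" for t t' n
    using lift_Suc_antimono_le[of "\<lambda>t. B t n", OF B_Suc that] .
  have B_project: "\<exists>t'. tr l (B t' l) \<subseteq> pre (s k) (s l) (tr k (B t k))" if kl: "k \<le> l" for k l t
  proof -
    obtain t' where t': "t \<le> t'" "visit t' = l" using visit_again by blast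
    then have "tr l (B (Suc t') l) \<subseteq> M (B t') l" using B(2)[of t'] by (auto simp: move_def)
    also have "\<dots> \<subseteq> pre (s k) (s l) (tr k (B t' k))" using kl by (auto simp: M_def)
    also have "\<dots> \<subseteq> pre (s k) (s l) (tr k (B t k))" using B_mono[OF t'(1)] by (auto simp: tr_def)
    finally show ?thesis by blast
  qed
  define F where "F n = {U. openin (X (s n)) U \<and> (\<exists>t. tr n (B t n) \<subseteq> U)}" for n
  have F_scott: "scott_open_family (X (s n)) (F n)" for n
    unfolding F_def tr_def
  proof (rule scott_open_family_gdelta_chart[where b = "\<lambda>t. B t n", OF chart B_open B_Suc])
    fix t
    obtain t' where t': "t \<le> t'" "visit t' = n" using visit_again by blast
    then show "\<exists>t'\<ge>t. \<exists>Q. compactin (Y n) Q \<and> B (Suc t') n \<subseteq> Q \<and> Q \<subseteq> B t' n \<inter> G n t'"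
      using B(2)[of t'] by (auto simp: move_def)
  qed
  have F_transfer: "pre (s k) (s l) ` F k \<subseteq> F l" if kl: "k \<le> l" for k l
  proof
    fix U' assume "U' \<in> pre (s k) (s l) ` F k"
    then obtain U t where U: "U' = pre (s k) (s l) U" "openin (X (s k)) U" "tr k (B t k) \<subseteq> U"
      by (auto simp: F_def)
    obtain t' where "tr l (B t' l) \<subseteq> pre (s k) (s l) (tr k (B t k))"
      using B_project[OF kl] by blast
    also have "\<dots> \<subseteq> U'" using U(1,3) by auto
    finally show "U' \<in> F l"
      using openin_pre[OF s_mono[OF kl] U(2)] U(1) by (auto simp: F_def)
  qed
  have F_Int: "U \<inter> U' \<in> F n" if U: "U \<in> F n" "U' \<in> F n" for U U' n
  proof -
    obtain t t' where "tr n (B t n) \<subseteq> U" "tr n (B t' n) \<subseteq> U'" using U by (auto simp: F_def)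
    then have "tr n (B (max t t') n) \<subseteq> U \<inter> U'"
      using B_mono[of t "max t t'" n] B_mono[of t' "max t t'" n] by (auto simp: tr_def)
    then show ?thesis using U by (auto simp: F_def)
  qed
  have W_F: "W (s n) \<notin> F n" for n
  proof
    assume "W (s n) \<in> F n"
    then obtain t where t: "tr n (B t n) \<subseteq> W (s n)" by (auto simp: F_def)
    define u where "u = max n t"
    have nu: "n \<le> u" "t \<le> u" by (simp_all add: u_def)
    have "M (B u) u \<subseteq> pre (s n) (s u) (tr n (B u n))" using nu by (auto simp: M_def)
    also have "\<dots> \<subseteq> pre (s n) (s u) (W (s n))" using B_mono[OF nu(2), of n] t by (auto simp: tr_def)
    also have "\<dots> \<subseteq> W (s u)" by (rule compatible_pre[OF W s_mono[OF nu(1)]])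
    finally have "\<nu> (s u) (M (B u) u) \<le> \<nu> (s u) (W (s u))"
      by (rule continuous_valuation_mono[OF val M_open[of "B u", OF B_open]
            compatible_openin[OF W sI]])
    then have "c < \<nu> (s u) (W (s u))" using B_mass[of u] by (rule less_le_trans[rotated])
    then show False using light sI by blast
  qed
  show False
  proof (rule limit_point_of_scott_filters[of UNIV s F W])
    show "\<exists>l\<in>UNIV. (s k, s l) \<in> r \<and> (s k', s l) \<in> r \<and> pre (s k) (s l) ` F k \<subseteq> F l \<and>
        pre (s k') (s l) ` F k' \<subseteq> F l" for k k'
      by (intro bexI[of _ "max k k'"] conjI s_mono F_transfer) simp_all
    show "topspace (X (s n)) \<in> F n" for n by (auto simp: F_def tr_def)
    show "\<exists>n\<in>UNIV. (i, s n) \<in> r" if "i \<in> I" for i using s(2)[OF that] by simp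
    fix x assume x: "x \<in> topspace L" "\<And>j. j \<in> I \<Longrightarrow> x j \<notin> W j"
      "\<And>k A. k \<in> UNIV \<Longrightarrow> A \<in> F k \<Longrightarrow> x (s k) \<in> A"
    have "V \<in> F 0" using B(1)[of 0] V(1) by (auto simp: F_def inv_def)
    then have "x (s 0) \<in> V" using x(3)[of 0 V] by simp
    then show False using cover x(1,2) by blast
  qed (use sober sI F_scott F_Int W W_F in auto)
qed

lemma cofinal_sequence:
  assumes "countably_cofinal I r" "i \<in> I"
  obtains s :: "nat \<Rightarrow> 'i" where "s 0 = i" "\<And>n. (s n, s (Suc n)) \<in> r"
    "\<And>j. j \<in> I \<Longrightarrow> \<exists>n. (j, s n) \<in> r"
proof -
  obtain J where J: "J \<subseteq> I" "countable J" "\<And>j. j \<in> I \<Longrightarrow> \<exists>k\<in>J. (j, k) \<in> r"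
    using assms(1) unfolding countably_cofinal_def by blast
  have J_ne: "J \<noteq> {}" using J(3)[OF assms(2)] by blast
  let ?e = "from_nat_into J"
  have e: "?e n \<in> I" for n using from_nat_into[OF J_ne] J(1) by blast
  have "\<exists>s. \<forall>n. (s n \<in> I \<and> (n = 0 \<longrightarrow> s n = i)) \<and> ((s n, s (Suc n)) \<in> r \<and> (?e n, s (Suc n)) \<in> r)"
  proof (rule dependent_nat_choice)
    show "\<exists>x. x \<in> I \<and> ((0::nat) = 0 \<longrightarrow> x = i)" using assms(2) by blast
    fix x and n :: nat assume "x \<in> I \<and> (n = 0 \<longrightarrow> x = i)"
    then have "x \<in> I" by simp
    then obtain y where "(x, y) \<in> r" "(?e n, y) \<in> r" "y \<in> I" using index_upper_bound[OF _ e] by blast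
    then show "\<exists>y. (y \<in> I \<and> (Suc n = 0 \<longrightarrow> y = i)) \<and> (x, y) \<in> r \<and> (?e n, y) \<in> r" by blast
  qed
  then obtain s where s: "\<And>n. n = 0 \<longrightarrow> s n = i" "\<And>n. (s n, s (Suc n)) \<in> r"
    "\<And>n. (?e n, s (Suc n)) \<in> r" by blast
  have "\<exists>n. (j, s n) \<in> r" if j: "j \<in> I" for j
  proof -
    obtain k where k: "k \<in> J" "(j, k) \<in> r" using J(3)[OF j] by blast
    then obtain n where "?e n = k" using from_nat_into_surj[OF J(2)] by blast
    then show ?thesis using s(3)[of n] k(2) index_trans by blast
  qed
  then show ?thesis using that[of s] s(1,2) by blast
qed

lemma tight_lcs_complete:
  assumes cof: "countably_cofinal I r"
    and lcs: "\<And>i. i \<in> I \<Longrightarrow> lcs_complete TYPE('c) (X i)" and \<nu>: "thread \<nu>"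
  shows "tight \<nu>"
proof (rule tightI)
  fix i V W c
  assume i: "i \<in> I" and V: "openin (X i) V" and W: "compatible W"
    and cover: "lpre i V \<subseteq> (\<Union>j\<in>I. lpre j (W j))" and c: "c < \<nu> i V"
  have charts: "\<exists>(Y :: 'c topology) h G. gdelta_chart (X j) Y h G" if "j \<in> I" for j
    using lcs_complete_gdelta_chart[OF lcs[OF that]] by metis
  have sober: "sober_space (X j)" if "j \<in> I" for j
    using charts[OF that] sober_gdelta_chart by blast
  obtain s where s: "s 0 = i" "\<And>n. (s n, s (Suc n)) \<in> r" "\<And>j. j \<in> I \<Longrightarrow> \<exists>n. (j, s n) \<in> r"
    using cofinal_sequence[OF cof i] by blast
  have "\<forall>n. \<exists>(Y :: 'c topology) h G. gdelta_chart (X (s n)) Y h G"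
    using charts index_mem(1)[OF s(2)] by blast
  then obtain Y :: "nat \<Rightarrow> 'c topology" and h G
    where chart: "\<And>n. gdelta_chart (X (s n)) (Y n) (h n) (G n)" by metis
  show "\<exists>j\<in>I. c < \<nu> j (W j)"
    using tight_gdelta_sequence[of s Y h G, OF sober s(2,3) chart \<nu> _ _ W, of V c]
      V c cover s(1) by blast
qed

end

section \<open>Valuations on a projective limit\<close>

theorem theorem4p3:
  fixes I :: "'i set" and r :: "'i rel"
    and X :: "'i \<Rightarrow> 'a topology" and p :: "'i \<Rightarrow> 'i \<Rightarrow> 'a \<Rightarrow> 'a"
    and T :: valuation_functor
  assumes "projective_system I r X p"
    and "ep_system I r X p
       \<or> (countably_cofinal I r \<and> (\<forall>i\<in>I. loc_compact_space (X i) \<and> sober_space (X i)))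
       \<or> (countably_cofinal I r \<and> T \<in> {Val_b, Val_1, Val_le1} \<and>
            (\<forall>i\<in>I. lcs_complete TYPE('c) (X i)))
       \<or> ((\<forall>i\<in>I. consonant_space (X i) \<and> sober_space (X i)) \<and>
            (\<forall>i j. (i, j) \<in> r \<longrightarrow> order_proper_map (X j) (X i) (p i j)))"
  shows "projective_system I r (\<lambda>i. val_space T (X i)) (\<lambda>i j. val_map (X j) (X i) (p i j))
       \<and> is_proj_lim I r (\<lambda>i. val_space T (X i)) (\<lambda>i j. val_map (X j) (X i) (p i j))
           (val_space T (proj_lim I r X p)) (\<lambda>i. val_map (proj_lim I r X p) (X i) (\<lambda>x. x i))"
proof -
  interpret projective_sys I r X p by unfold_locales (rule assms(1))
  have "tight \<nu>" if \<nu>: "thread \<nu>" for \<nu>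
    using assms(2)
  proof (elim disjE conjE)
    assume "ep_system I r X p"
    then show ?thesis using \<nu> by (rule tight_ep_system)
  next
    assume cof: "countably_cofinal I r"
      and lc: "\<forall>i\<in>I. loc_compact_space (X i) \<and> sober_space (X i)"
    have "lcs_complete TYPE('a) (X i)" if "i \<in> I" for i
      using lc that by (intro lcs_complete_locally_compact) auto
    then show ?thesis using tight_lcs_complete[OF cof _ \<nu>] by blast
  next
    assume cof: "countably_cofinal I r" and lcs: "\<forall>i\<in>I. lcs_complete TYPE('c) (X i)"
    show ?thesis by (rule tight_lcs_complete[OF cof _ \<nu>, where ?'c = 'c]) (use lcs in blast)
  next
    assume "\<forall>i\<in>I. consonant_space (X i) \<and> sober_space (X i)"
      and "\<forall>i j. (i, j) \<in> r \<longrightarrow> order_proper_map (X j) (X i) (p i j)"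
    then show ?thesis using \<nu> by (intro tight_consonant) auto
  qed
  then show ?thesis
    using projective_system_val_space projective_limit_val_space by blast
qed

end
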